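(* As $n\to\infty$, we have $$\begin{aligned} F_n(f_1)={}&\frac{2|\Phi|}{\pi\sqrt{|d|}}n^2\log n+\frac{|\Phi|}{\pi^2\sqrt{|d|}}\bigg[2\pi(\gamma-\log2)-4\pi\log|\eta(\mu)|\\ &\qquad+\Big(\frac\pi2-\arctan\Big(\frac{c-a}{\sqrt{|d|}}\Big)\Big)\log\Big(\frac ca\Big)-C(a,b,c)\bigg]n^2\\ &+\frac{|\Phi|}{\pi^2}\bigg[\frac13\Big(\frac1{a-b+c}+\frac1{a+b+c}+\frac{\pi}{\sqrt{|d|}}\Big)-\frac{1+(-1)^n}{2}\Big(\frac{\pi}{\sqrt{|d|}}+\frac{2}{a-b+c}\Big)\bigg]+\mathcal O\Big(\frac{\log n}{n^2}\Big). \end{aligned}$$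
   Context: Let $\Phi=\{\mathbf b_1,\dots,\mathbf b_{|\Phi|}\}$ be a finite collection of nonzero vectors in a two-dimensional real vector space generating a lattice $\Lambda=\mathbb Z\Phi$ of full rank, with $\{\mathbf b_1,\mathbf b_2\}$ a basis of $\Lambda$. Write $\mathbf b_\ell=s_{1,\ell}\mathbf b_1+s_{2,\ell}\mathbf b_2$ and $\mathbf s_\ell=(s_{1,\ell},s_{2,\ell})\in\mathbb Z^2\setminus\{\mathbf 0\}$, so $\mathbf s_1=(1,0)$, $\mathbf s_2=(0,1)$. $\Phi$ is fixed. Put $$a=\sum_{\ell=1}^{|\Phi|}s_{1,\ell}^2,\quad b=2\sum_{\ell=1}^{|\Phi|}s_{1,\ell}s_{2,\ell},\quad c=\sum_{\ell=1}^{|\Phi|}s_{2,\ell}^2,\quad d=b^2-4ac\ (<0),\quad \mu=\frac{-b+\sqrt{|d|}\,i}{2c}.$$ Let $p_1(\mathbf x)=\frac1{2|\Phi|}\sum_{\ell=1}^{|\Phi|}(\mathbf s_\ell\cdot\mathbf x)^2$ and $f_1=1/p_1$, i.e. $f_1(x,y)=\frac{2|\Phi|}{ax^2+bxy+cy^2}$. For a positive integer $n$ let $t_j=2\pi j/n$ and $x_j=t_j-\pi/n$ ($j\in\mathbb Z$), $\mathbf t_{j,k}=(t_j,t_k)$, $X_{j,k}=[x_j,x_{j+1}]\times[x_k,x_{k+1}]$, $D_n=\bigcup_{\mathbf t_{j,k}\in[-\pi,\pi)^2\setminus\{\mathbf 0\}}X_{j,k}$, and $F_n(f_1)=\sum_{\mathbf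 t_{j,k}\in D_n}f_1(\mathbf t_{j,k})$ (equivalently, the sum over $\mathbf t_{j,k}\in[-\pi,\pi)^2\setminus\{\mathbf 0\}$). $\gamma$ is Euler's constant; $\eta(\tau)=e^{\pi i\tau/12}\prod_{k\ge1}(1-e^{2\pi ik\tau})$ ($\Im\tau>0$) is the Dedekind eta-function; $\mathrm{Cl}_2(\theta)=\sum_{k\ge1}\frac{\sin k\theta}{k^2}$ is the Clausen function; and $$\begin{aligned}C(a,b,c)={}&\mathrm{Cl}_2\Big(\pi-2\arctan\Big(\frac{2a-b}{\sqrt{|d|}}\Big)\Big)+\mathrm{Cl}_2\Big(\pi-2\arctan\Big(\frac{2a+b}{\sqrt{|d|}}\Big)\Big)\\&+\mathrm{Cl}_2\Big(\pi-2\arctan\Big(\frac{2c-b}{\sqrt{|d|}}\Big)\Big)+\mathrm{Cl}_2\Big(\pi-2\arctan\Big(\frac{2c+b}{\sqrt{|d|}}\Big)\Big).\end{aligned}$$ *)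

theory Defs
  imports "HOL-Analysis.Analysis" "HOL-Library.Landau_Symbols"
begin

definition int_span :: "'v::real_vector set \<Rightarrow> 'v set" where
  "int_span S = {(\<Sum>v\<in>T. real_of_int (k v) *\<^sub>R v) | T k. finite T \<and> T \<subseteq> S}"

definition is_lattice_basis :: "'v::real_vector set \<Rightarrow> 'v set \<Rightarrow> bool" where
  "is_lattice_basis B L \<longleftrightarrow> independent B \<and> int_span B = L"

definition Cl2 :: "real \<Rightarrow> real" where
  "Cl2 \<theta> = (\<Sum>k. sin (real (k + 1) * \<theta>) / (real (k + 1))\<^sup>2)"

definition dedekind_eta :: "complex \<Rightarrow> complex" where
  "dedekind_eta \<tau> = exp (of_real pi * \<i> * \<tau> / 12) *
     (\<Prod>k. 1 - exp (2 * of_real pi * \<i> * of_nat (k + 1) * \<tau>))"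

definition clausen_C :: "real \<Rightarrow> real \<Rightarrow> real \<Rightarrow> real" where
  "clausen_C a b c = (let r = sqrt \<bar>b\<^sup>2 - 4 * a * c\<bar> in
     Cl2 (pi - 2 * arctan ((2 * a - b) / r)) + Cl2 (pi - 2 * arctan ((2 * a + b) / r)) +
     Cl2 (pi - 2 * arctan ((2 * c - b) / r)) + Cl2 (pi - 2 * arctan ((2 * c + b) / r)))"

definition p1 :: "nat \<Rightarrow> (nat \<Rightarrow> int) \<Rightarrow> (nat \<Rightarrow> int) \<Rightarrow> real \<times> real \<Rightarrow> real" where
  "p1 N s1 s2 = (\<lambda>(x, y). 1 / (2 * real N) *
     (\<Sum>l = 1..N. (real_of_int (s1 l) * x + real_of_int (s2 l) * y)\<^sup>2))"

definition f1 :: "nat \<Rightarrow> (nat \<Rightarrow> int) \<Rightarrow> (nat \<Rightarrow> int) \<Rightarrow> real \<times> real \<Rightarrow> real" where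
  "f1 N s1 s2 = (\<lambda>x. 1 / p1 N s1 s2 x)"

definition grid :: "nat \<Rightarrow> int \<Rightarrow> real" where
  "grid n j = 2 * pi * of_int j / real n"

definition grid_edge :: "nat \<Rightarrow> int \<Rightarrow> real" where
  "grid_edge n j = grid n j - pi / real n"

definition grid_pt :: "nat \<Rightarrow> int \<Rightarrow> int \<Rightarrow> real \<times> real" where
  "grid_pt n j k = (grid n j, grid n k)"

definition grid_cell :: "nat \<Rightarrow> int \<Rightarrow> int \<Rightarrow> (real \<times> real) set" where
  "grid_cell n j k =
     {grid_edge n j .. grid_edge n (j + 1)} \<times> {grid_edge n k .. grid_edge n (k + 1)}"

definition punctured_square :: "(real \<times> real) set" where
  "punctured_square = {-pi..<pi} \<times> {-pi..<pi} - {(0, 0)}"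

definition grid_region :: "nat \<Rightarrow> (real \<times> real) set" where
  "grid_region n = \<Union>{grid_cell n j k | j k. grid_pt n j k \<in> punctured_square}"

definition grid_sum :: "nat \<Rightarrow> (real \<times> real \<Rightarrow> real) \<Rightarrow> real" where
  "grid_sum n f = (\<Sum>(j, k) \<in> {(j, k). grid_pt n j k \<in> grid_region n}. f (grid_pt n j k))"

text \<open>The index set of \<^const>\<open>grid_sum\<close> is finite, and it is the one obtained by taking
  the grid points of the punctured square itself.\<close>

lemma grid_in_cell_iff:
  assumes "n > 0"
  shows "grid n i \<in> {grid_edge n j .. grid_edge n (j + 1)} \<longleftrightarrow> i = j"
proof -
  have "grid n i \<in> {grid_edge n j .. grid_edge n (j + 1)} \<longleftrightarrow>
      pi * (2 * of_int j - 1) \<le> pi * (2 * of_int i) \<and> pi * (2 * of_int i) \<le> pi * (2 * of_int j + 1)"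
  proof -
    have "grid n i = pi * (2 * of_int i) / real n"
      "grid_edge n j = pi * (2 * of_int j - 1) / real n"
      "grid_edge n (j + 1) = pi * (2 * of_int j + 1) / real n"
      unfolding grid_edge_def grid_def of_int_add of_int_1 diff_divide_distrib[symmetric]
      by (simp_all add: algebra_simps)
    then show ?thesis
      using assms by (simp only: atLeastAtMost_iff divide_le_cancel) simp
  qed
  also have "\<dots> \<longleftrightarrow> 2 * real_of_int j - 1 \<le> 2 * of_int i \<and> 2 * real_of_int i \<le> 2 * of_int j + 1"
    using pi_gt_zero by (simp only: mult_le_cancel_left_pos)
  also have "\<dots> \<longleftrightarrow> i = j" by linarith
  finally show ?thesis .
qed

lemma grid_pt_in_region_iff:
  assumes "n > 0"
  shows "grid_pt n j k \<in> grid_region n \<longleftrightarrow> grid_pt n j k \<in> punctured_square"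
proof -
  have cell: "grid_pt n j k \<in> grid_cell n j' k' \<longleftrightarrow> j = j' \<and> k = k'" for j' k'
    unfolding grid_pt_def grid_cell_def mem_Times_iff fst_conv snd_conv
      grid_in_cell_iff[OF assms] ..
  have "grid_pt n j k \<in> grid_region n \<longleftrightarrow>
      (\<exists>j' k'. grid_pt n j' k' \<in> punctured_square \<and> grid_pt n j k \<in> grid_cell n j' k')"
    unfolding grid_region_def by blast
  also have "\<dots> \<longleftrightarrow> grid_pt n j k \<in> punctured_square"
    unfolding cell by auto
  finally show ?thesis .
qed

lemma finite_grid_index:
  assumes "n > 0"
  shows "finite {(j, k). grid_pt n j k \<in> grid_region n}"
proof (rule finite_subset)
  have "j \<in> {- int n..int n}" if "grid n j \<in> {-pi..<pi}" for j
  proof -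
    have "pi * (- real n) \<le> pi * (2 * of_int j)" "pi * (2 * of_int j) < pi * real n"
      using that assms by (auto simp: grid_def field_simps)
    then have "- real n \<le> 2 * of_int j" "2 * of_int j < real n"
      using pi_gt_zero by (simp_all only: mult_le_cancel_left_pos mult_less_cancel_left_pos)
    then show ?thesis unfolding atLeastAtMost_iff by linarith
  qed
  then show "{(j, k). grid_pt n j k \<in> grid_region n} \<subseteq> {- int n..int n} \<times> {- int n..int n}"
    unfolding grid_pt_in_region_iff[OF assms] by (auto simp: punctured_square_def grid_pt_def)
qed simp

end

theory Submission
  imports Defs "HOL-Real_Asymp.Real_Asymp"
begin

text \<open>
  With \<open>Q x y = a x\<^sup>2 + b x y + c y\<^sup>2\<close> the grid sum is \<open>N n\<^sup>2 / (2 \<pi>\<^sup>2)\<close> times the sum of \<open>1 / Q\<close> over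
  the nonzero lattice points of \<open>[-n/2, n/2)\<^sup>2\<close>. Passing from the box \<open>\<bar>j\<bar>, \<bar>k\<bar> \<le> m - 1\<close> to
  \<open>\<bar>j\<bar>, \<bar>k\<bar> \<le> m\<close> adds four trapezoidal sums, one for each side, which Euler--Maclaurin expands as
  \<open>A/m + B/m\<^sup>3 + O(m\<^sup>-\<^sup>5)\<close>; telescoping gives all terms but the constant one, and for even \<open>n\<close> the
  reflection \<open>(j, k) \<mapsto> (-j, -k)\<close> expresses the half-open square through two consecutive boxes.
  The constant is found as in Kronecker's first limit formula: summing \<open>1 / Q\<close> over the whole
  column \<open>j \<noteq> 0\<close> by the partial fractions of the cotangent produces the logarithm of \<open>\<eta>\<close>, and the
  part \<open>\<bar>k\<bar> > J \<ge> \<bar>j\<bar>\<close> to be removed is a Riemann sum of \<open>beta(t)/t\<close> for an angle \<open>beta\<close>, whose integral is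
  the imaginary part of a dilogarithm and hence a sum of Clausen values.
\<close>

section \<open>The Clausen function\<close>

text \<open>The sum of \<open>1 / Q\<close> over all lattice points diverges logarithmically, so the
  shape of the truncation affects the constant. Whole columns lead to the eta function, but the sums
  wanted are over square boxes, and the discrepancy does not vanish in the limit: it is the origin
  of \<open>clausen_C\<close> and of \<open>ln (c / a)\<close>. This comparison gives the constant
  as a limit without a rate; the telescoped rings give the rate without the constant, so both are
  needed. The remainder is measured against \<open>ln (2 * n + 1)\<close> because
  \<open>2 * n + 1\<close> is the grid size whose half-open square is the box of radius
  \<open>n\<close>. Centred in this way, the increments of the logarithm and of its quadratic
  correction are odd in the radius \<open>m\<close>, and one correction already leaves
  \<open>O(m^-5)\<close>. After multiplication by \<open>n^2\<close> the error is
  \<open>O(n^-2)\<close>, inside the stated bound. Changing the sign of \<open>b\<close> and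
  exchanging \<open>a\<close> and \<open>c\<close> carry one half-side of the box into the others,
  which is why the argument lives in a locale that is interpreted for several forms.\<close>

lemma summable_inverse_Suc_square: "summable (\<lambda>k. 1 / (real (k + 1))\<^sup>2)"
  using inverse_squares_sums by (simp add: sums_iff add.commute)

lemma Cl2_0 [simp]: "Cl2 0 = 0"
  by (simp add: Cl2_def)

lemma Cl2_term_bound: "norm (sin (real (k + 1) * x) / (real (k + 1))\<^sup>2) \<le> 1 / (real (k + 1))\<^sup>2"
  by (simp add: abs_mult divide_right_mono)

lemma Cl2_reflect: "Cl2 (2 * pi - x) = - Cl2 x"
proof -
  have "sin (real (k + 1) * (2 * pi - x)) = - sin (real (k + 1) * x)" for k
    using sin_diff[of "real (k+1) * (2*pi)" "real (k+1) * x"] sin_npi2[of "2 * (k + 1)"]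
      cos_npi2[of "2 * (k + 1)"]
    by (simp add: algebra_simps)
  then show ?thesis
    unfolding Cl2_def
    by (simp only: minus_divide_left[symmetric])
      (rule suminf_minus, rule summable_comparison_test'[OF summable_inverse_Suc_square Cl2_term_bound])
qed

lemma continuous_on_Cl2: "continuous_on A Cl2"
proof -
  have "uniform_limit A (\<lambda>n x. \<Sum>k<n. sin (real (k + 1) * x) / (real (k + 1))\<^sup>2) Cl2 sequentially"
    unfolding Cl2_def
    by (rule Weierstrass_m_test[OF _ summable_inverse_Suc_square]) (rule Cl2_term_bound)
  then show ?thesis
    by (rule uniform_limit_theorem[rotated]) (auto intro!: continuous_intros always_eventually)
qed

lemma norm_one_minus_cis:
  assumes "0 \<le> x" "x \<le> 2 * pi"
  shows "cmod (1 - cis x) = 2 * sin (x / 2)"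
proof -
  have "(cmod (1 - cis x))\<^sup>2 = (1 - cos x)\<^sup>2 + (sin x)\<^sup>2"
    by (simp add: cmod_power2)
  also have "\<dots> = 2 - 2 * cos x"
    using sin_cos_squared_add[of x] by (simp add: power2_eq_square algebra_simps)
  also have "\<dots> = (2 * sin (x / 2))\<^sup>2"
    using cos_double_sin[of "x/2"] by (simp add: power2_eq_square algebra_simps)
  finally show ?thesis
    using assms sin_ge_zero[of "x/2"] by (intro power2_eq_imp_eq[of "cmod (1 - cis x)"]) simp_all
qed

text \<open>This is the real part of the power series of \<open>- ln (1 - w)\<close> at
  \<open>w = r * cis x\<close>.\<close>

lemma sums_cos_over_Suc:
  assumes "0 \<le> r" "r < 1"
  shows "(\<lambda>k. r ^ (k + 1) * cos (real (k + 1) * x) / real (k + 1)) sums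
    (- ln (cmod (1 - of_real r * cis x)))"
proof -
  define w where "w = of_real r * cis x"
  have w: "cmod w < 1" using assms by (simp add: w_def norm_mult)
  have "(\<lambda>n. Re (- ((- (- w)) ^ n) / of_nat n)) sums Re (ln (1 + (- w)))"
    using w by (intro sums_Re Ln_series') simp
  then have s: "(\<lambda>n. - Re (w ^ n / of_nat n)) sums Re (ln (1 - w))" by simp
  have "Re (ln (1 - w)) = ln (cmod (1 - w))"
    using w by (intro Re_Ln) auto
  moreover have "Re (w ^ n / of_nat n) = r ^ n * cos (real n * x) / real n" for n
    unfolding w_def power_mult_distrib Complex.DeMoivre of_real_power[symmetric] Re_divide_of_nat
    by simp
  ultimately have "(\<lambda>n. r ^ n * cos (real n * x) / real n) sums (- ln (cmod (1 - w)))"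
    using sums_minus[OF s] by (simp only: minus_minus)
  \<comment> \<open>The term of index 0 is a quotient by 0, hence 0, so the series may start at
    index 1.\<close>
  then have "(\<lambda>n. r ^ Suc n * cos (real (Suc n) * x) / real (Suc n)) sums (- ln (cmod (1 - w)))"
    unfolding sums_Suc_iff[of "\<lambda>n. r ^ n * cos (real n * x) / real n"] by simp
  then show ?thesis by (simp add: w_def)
qed

text \<open>For \<open>r = 1\<close> the differentiated series has terms of size \<open>1/k\<close>
  and admits no summable majorant. The Abel factor \<open>r ^ (k + 1)\<close> supplies a geometric
  one, and termwise differentiation becomes legitimate.\<close>

lemma Abel_Cl2_deriv:
  assumes "0 \<le> r" "r < 1"
  shows "((\<lambda>x. \<Sum>k. r ^ (k + 1) * (sin (real (k + 1) * x) / (real (k + 1))\<^sup>2))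
    has_field_derivative (- ln (cmod (1 - of_real r * cis x)))) (at x)"
proof -
  have *: "\<bar>r ^ (k + 1) * cos (real (k + 1) * y) / real (k + 1)\<bar> \<le> r ^ (k + 1)" for k y
  proof -
    have "\<bar>r ^ (k + 1) * cos (real (k + 1) * y) / real (k + 1)\<bar>
      = r ^ (k + 1) * (\<bar>cos (real (k + 1) * y)\<bar> / real (k + 1))"
      using assms by (simp add: abs_mult)
    also have "\<dots> \<le> r ^ (k + 1) * 1"
    proof (rule mult_left_mono)
      show "\<bar>cos (real (k + 1) * y)\<bar> / real (k + 1) \<le> 1"
        using abs_cos_le_one[of "real (k+1) * y"] by (subst divide_le_eq_1_pos) linarith+
    qed (use assms in auto)
    finally show ?thesis by simp
  qed
  have "summable (\<lambda>k. r ^ (k + 1))" using assms by (simp add: summable_geometric)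
  then have u: "uniformly_convergent_on UNIV
      (\<lambda>n x. \<Sum>k<n. r ^ (k + 1) * cos (real (k + 1) * x) / real (k + 1))"
    by (intro Weierstrass_m_test'[where M = "\<lambda>k. r ^ (k + 1)"]) (use * in auto)
  have "((\<lambda>x. \<Sum>k. r ^ (k + 1) * (sin (real (k + 1) * x) / (real (k + 1))\<^sup>2))
      has_field_derivative (\<Sum>k. r ^ (k + 1) * cos (real (k + 1) * x) / real (k + 1))) (at x)"
  proof (rule has_field_derivative_series'(2)[OF convex_UNIV _ u])
    have "((\<lambda>x. s * (sin (t * x) / t\<^sup>2)) has_field_derivative s * cos (t * y) / t) (at y within UNIV)"
      if "t > 0" for s t y :: real
      using that by (auto intro!: derivative_eq_intros simp: power2_eq_square)
    then show "((\<lambda>x. r ^ (k + 1) * (sin (real (k + 1) * x) / (real (k + 1))\<^sup>2)) has_field_derivative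
         r ^ (k + 1) * cos (real (k + 1) * y) / real (k + 1)) (at y within UNIV)" for k y
      by simp
    show "summable (\<lambda>k. r ^ (k + 1) * (sin (real (k + 1) * 0) / (real (k + 1))\<^sup>2))" by simp
  qed auto
  then show ?thesis using sums_cos_over_Suc[OF assms, of x] by (simp add: sums_iff)
qed

text \<open>The weights \<open>r ^ (k + 1)\<close> with \<open>r = n / (n + 1)\<close> increase to
  1, and the terms stay below \<open>1/k^2\<close> uniformly in \<open>n\<close>, so Tannery's
  theorem applies.\<close>

lemma Abel_Cl2_limit:
  "(\<lambda>n. \<Sum>k. (real n / (real n + 1)) ^ (k + 1) * (sin (real (k + 1) * x) / (real (k + 1))\<^sup>2))
    \<longlonglongrightarrow> Cl2 x"
proof -
  have *: "norm ((real n / (real n + 1)) ^ (k + 1) * (sin (real (k + 1) * x) / (real (k + 1))\<^sup>2))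
    \<le> 1 / (real (k + 1))\<^sup>2" for n k
  proof -
    have "\<bar>(real n / (real n + 1)) ^ (k + 1)\<bar> \<le> 1"
      unfolding power_abs by (intro power_le_one) auto
    then show ?thesis
      using mult_mono[OF _ Cl2_term_bound, of "\<bar>(real n / (real n + 1)) ^ (k + 1)\<bar>" 1 k x]
      by (simp only: abs_mult real_norm_def mult_1 abs_ge_zero zero_le_one simp_thms)
  qed
  have lim: "(\<lambda>n. (real n / (real n + 1)) ^ (k + 1) * (sin (real (k + 1) * x) / (real (k + 1))\<^sup>2))
        \<longlonglongrightarrow> sin (real (k + 1) * x) / (real (k + 1))\<^sup>2" for k
  proof -
    have "(\<lambda>n. real n / (real n + 1)) \<longlonglongrightarrow> 1" by real_asymp
    then have "(\<lambda>n. (real n / (real n + 1)) ^ (k + 1) * (sin (real (k + 1) * x) / (real (k + 1))\<^sup>2))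
        \<longlonglongrightarrow> 1 ^ (k + 1) * (sin (real (k + 1) * x) / (real (k + 1))\<^sup>2)"
      by (intro tendsto_intros)
    then show ?thesis by simp
  qed
  have "\<forall>\<^sub>F (k, n) in sequentially \<times>\<^sub>F sequentially.
      norm ((real n / (real n + 1)) ^ (k + 1) * (sin (real (k + 1) * x) / (real (k + 1))\<^sup>2))
      \<le> 1 / (real (k + 1))\<^sup>2"
    unfolding case_prod_beta by (rule always_eventually, rule allI, rule *)
  from tannerys_theorem[of
      "\<lambda>k n. (real n / (real n + 1)) ^ (k + 1) * (sin (real (k + 1) * x) / (real (k + 1))\<^sup>2)"
      "\<lambda>k. sin (real (k + 1) * x) / (real (k + 1))\<^sup>2" sequentially, OF lim this summable_inverse_Suc_square]
  show ?thesis unfolding Cl2_def by (simp only: trivial_limit_sequentially simp_thms)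
qed

lemma abs_ln_diff_le:
  assumes "m > 0" "u \<ge> m" "v \<ge> m"
  shows "\<bar>ln u - ln v\<bar> \<le> \<bar>u - v\<bar> / (m::real)"
proof -
  have "ln u - ln v \<le> \<bar>u - v\<bar> / m" if "u \<ge> m" "v \<ge> m" for u v
  proof -
    have uv: "u > 0" "v > 0" using that assms(1) by auto
    then have "ln u - ln v = ln (u / v)" by (simp add: ln_div)
    also have "\<dots> \<le> u / v - 1" using uv by (intro ln_le_minus_one) auto
    also have "\<dots> = (u - v) / v" using uv by (simp add: field_simps)
    also have "\<dots> \<le> \<bar>u - v\<bar> / v" using uv by (intro divide_right_mono) auto
    also have "\<dots> \<le> \<bar>u - v\<bar> / m" using that assms(1) by (intro divide_left_mono) auto
    finally show ?thesis .
  qed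
  from this[of u v] this[of v u] assms show ?thesis by (simp add: abs_minus_commute abs_le_iff)
qed

lemma abs_diff_mult_le: "\<bar>u - v\<bar> \<le> e \<Longrightarrow> \<bar>u * h - v * h\<bar> \<le> e * \<bar>h\<bar>" for u v e h :: real
  using mult_right_mono[of "\<bar>u - v\<bar>" e "\<bar>h\<bar>"] by (simp add: abs_mult flip: left_diff_distrib)

text \<open>The Abel means have derivative \<open>- ln (cmod (1 - r * cis y))\<close>. Away from 0
  and \<open>2 * pi\<close> this converges uniformly to \<open>- ln (cmod (1 - cis y))\<close> as
  \<open>r\<close> tends to 1, so the limit of the derivatives is the derivative of the
  limit.\<close>

lemma DERIV_Cl2:
  assumes "0 < x" "x < 2 * pi"
  shows "(Cl2 has_field_derivative (- ln (2 * sin (x / 2)))) (at x)"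
proof -
  \<comment> \<open>A compact neighbourhood of \<open>x\<close> inside the open interval; its ends
    are the midpoints between \<open>x\<close> and 0 and between \<open>x\<close> and
    \<open>2 * pi\<close>.\<close>
  define S where "S = {x / 2..(x + 2 * pi) / 2}"
  have S: "y > 0" "y < 2 * pi" if "y \<in> S" for y using that assms by (auto simp: S_def)
  have x: "x \<in> interior S" "x \<in> S" using assms by (auto simp: S_def interior_atLeastAtMost_real)
  have sinp: "sin (y / 2) > 0" if "y \<in> S" for y using S[OF that] by (intro sin_gt_zero) auto
  obtain m where m: "m > 0" "\<And>y. y \<in> S \<Longrightarrow> m \<le> 2 * sin (y / 2)"
  proof -
    have "\<exists>z\<in>S. \<forall>y\<in>S. 2 * sin (z / 2) \<le> 2 * sin (y / 2)"
      using x unfolding S_def by (intro continuous_attains_inf) (auto intro!: continuous_intros)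
    then obtain z where z: "z \<in> S" "\<And>y. y \<in> S \<Longrightarrow> 2 * sin (z / 2) \<le> 2 * sin (y / 2)" by blast
    show ?thesis using sinp[OF z(1)] z(2) by (intro that[of "2 * sin (z / 2)"]) auto
  qed
  define f where "f n y = (\<Sum>k. (real n / (real n + 1)) ^ (k + 1) *
    (sin (real (k + 1) * y) / (real (k + 1))\<^sup>2))" for n y
  define f' where "f' n y = - ln (cmod (1 - of_real (real n / (real n + 1)) * cis y))" for n y
  have "\<exists>g. \<forall>y\<in>S. (\<lambda>n. f n y) \<longlonglongrightarrow> g y \<and>
      (g has_derivative (\<lambda>h. - ln (2 * sin (y / 2)) * h)) (at y within S)"
  proof (rule has_derivative_sequence[of S f "\<lambda>n y h. f' n y * h" "\<lambda>y h. - ln (2 * sin (y / 2)) * h" x "Cl2 x"])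
    show "convex S" by (simp add: S_def)
    have "(f n has_field_derivative f' n y) (at y)" for n y
      unfolding f_def f'_def by (rule Abel_Cl2_deriv) auto
    then show "(f n has_derivative (\<lambda>h. f' n y * h)) (at y within S)" for n y
      unfolding has_field_derivative_def by (rule has_derivative_at_withinI)
    show "x \<in> S" by fact
    show "(\<lambda>n. f n x) \<longlonglongrightarrow> Cl2 x" unfolding f_def by (rule Abel_Cl2_limit)
    fix e :: real assume e: "e > 0"
    have lim: "(\<lambda>n. 1 - real n / (real n + 1)) \<longlonglongrightarrow> 0" by real_asymp
    have "\<forall>\<^sub>F n in sequentially. 1 - real n / (real n + 1) < min (m / 2) (e * (m / 2))"
      using order_tendstoD(2)[OF lim, of "min (m / 2) (e * (m / 2))"] e m(1) by simp
    then show "\<forall>\<^sub>F n in sequentially. \<forall>y\<in>S. \<forall>h.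
      norm (f' n y * h - - ln (2 * sin (y / 2)) * h) \<le> e * norm h"
    proof eventually_elim
      case (elim n)
      define r where "r = real n / (real n + 1)"
      \<comment> \<open>The first bound keeps the modulus above \<open>m / 2\<close>, where
        \<open>ln\<close> is Lipschitz with constant \<open>2 / m\<close>; the second then makes the
        error at most \<open>e\<close>.\<close>
      have r: "1 - r \<le> m / 2" "1 - r \<le> e * (m / 2)" "r \<le> 1" using elim by (auto simp: r_def)
      show ?case
      proof (intro ballI allI)
        fix y h assume y: "y \<in> S"
        have n: "cmod (1 - cis y) = 2 * sin (y / 2)" using S[OF y] by (intro norm_one_minus_cis) auto
        have "\<bar>cmod (1 - of_real r * cis y) - cmod (1 - cis y)\<bar>
            \<le> cmod ((1 - of_real r * cis y) - (1 - cis y))"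
          by (rule norm_triangle_ineq3)
        also have "(1 - of_real r * cis y) - (1 - cis y) = of_real (1 - r) * cis y"
          by (simp add: algebra_simps)
        also have "cmod \<dots> = 1 - r" using r by (simp only: norm_mult norm_of_real norm_cis) simp
        finally have d: "\<bar>cmod (1 - of_real r * cis y) - 2 * sin (y / 2)\<bar> \<le> 1 - r" by (simp add: n)
        have "\<bar>ln (cmod (1 - of_real r * cis y)) - ln (2 * sin (y / 2))\<bar>
           \<le> \<bar>cmod (1 - of_real r * cis y) - 2 * sin (y / 2)\<bar> / (m / 2)"
        proof (rule abs_ln_diff_le)
          show "m / 2 \<le> cmod (1 - of_real r * cis y)"
            using d m(2)[OF y] r(1) unfolding abs_le_iff by linarith
          show "0 < m / 2" "m / 2 \<le> 2 * sin (y / 2)"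
            using m(2)[OF y] m(1) by linarith+
        qed
        also have "\<dots> \<le> (e * (m / 2)) / (m / 2)" using d r m(1) by (intro divide_right_mono) auto
        also have "\<dots> = e" using m(1) by simp
        finally have "\<bar>f' n y - - ln (2 * sin (y / 2))\<bar> \<le> e" by (simp add: f'_def r_def)
        then show "norm (f' n y * h - - ln (2 * sin (y / 2)) * h) \<le> e * norm h"
          unfolding real_norm_def by (rule abs_diff_mult_le)
      qed
    qed
  qed
  then obtain g where g: "\<forall>y\<in>S. (\<lambda>n. f n y) \<longlonglongrightarrow> g y \<and>
      (g has_derivative (\<lambda>h. - ln (2 * sin (y / 2)) * h)) (at y within S)" ..
  have "Cl2 y = g y" if "y \<in> S" for y
    using Abel_Cl2_limit[of y] bspec[OF g that, THEN conjunct1] unfolding f_def by (rule LIMSEQ_unique)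
  from has_derivative_transform[of x S Cl2 g, OF x(2) this bspec[OF g x(2), THEN conjunct2]]
  show ?thesis
    unfolding has_field_derivative_def at_within_interior[OF x(1)] .
qed


section \<open>Binary quadratic forms and the dilogarithm\<close>

text \<open>The sum of the two angles lies strictly between 0 and \<open>pi\<close>, where the
  cotangent has no pole. Using its complement avoids the case split at \<open>u * v = 1\<close> of
  the usual addition formula.\<close>

lemma arctan_add_pos:
  assumes "u + v > 0"
  shows "arctan u + arctan v = pi / 2 - arctan ((1 - u * v) / (u + v))"
proof -
  define s where "s = arctan u + arctan v"
  have "arctan (- v) < arctan u" using assms by (simp only: arctan_less_iff)
  then have "s > 0" by (simp add: s_def arctan_minus)
  moreover have "s < pi" using arctan_ubound[of u] arctan_ubound[of v] by (simp add: s_def)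
  moreover have "tan (pi / 2 - s) = (1 - u * v) / (u + v)"
  proof -
    have p: "sqrt (1 + u\<^sup>2) > 0" "sqrt (1 + v\<^sup>2) > 0" by (auto intro: add_pos_nonneg)
    have "sin s = (u + v) / (sqrt (1 + u\<^sup>2) * sqrt (1 + v\<^sup>2))"
      by (simp add: s_def sin_add sin_arctan cos_arctan add_divide_distrib)
    moreover have "cos s = (1 - u * v) / (sqrt (1 + u\<^sup>2) * sqrt (1 + v\<^sup>2))"
      by (simp add: s_def cos_add sin_arctan cos_arctan diff_divide_distrib)
    ultimately show ?thesis
      using p by (simp add: tan_def sin_diff cos_diff)
  qed
  ultimately have "arctan ((1 - u * v) / (u + v)) = pi / 2 - s"
    by (intro arctan_unique) auto
  then show ?thesis by (simp add: s_def)
qed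

text \<open>On each cell the mean value theorem replaces the increment of \<open>F\<close> by a
  value of \<open>h\<close>, and uniform continuity compares it with the right endpoint.
  Differentiability is asked only in the open interval since the intended \<open>F\<close> is
  \<open>dilog\<close>, which has a \<open>t * ln t\<close> term at 0.\<close>

lemma right_riemann_sum_tendsto:
  fixes F h :: "real \<Rightarrow> real"
  assumes F: "continuous_on {0..1} F" and h: "continuous_on {0..1} h"
    and D: "\<And>t. 0 < t \<Longrightarrow> t < 1 \<Longrightarrow> (F has_field_derivative h t) (at t)"
  shows "(\<lambda>n. \<Sum>i<n. h (real (Suc i) / real n) / real n) \<longlonglongrightarrow> F 1 - F 0"
proof (rule LIMSEQ_I)
  fix e :: real assume e: "e > 0"
  have "uniformly_continuous_on {0..1} h"
    using h by (intro compact_uniformly_continuous) auto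
  then obtain d where d: "d > 0" "\<And>x y. x \<in> {0..1} \<Longrightarrow> y \<in> {0..1} \<Longrightarrow> dist y x < d \<Longrightarrow> dist (h y) (h x) < e / 2"
    unfolding uniformly_continuous_on_def using e by (meson half_gt_zero)
  obtain n0 :: nat where n0: "1 / d < real n0" using reals_Archimedean2 by blast
  show "\<exists>no. \<forall>n\<ge>no. norm ((\<Sum>i<n. h (real (Suc i) / real n) / real n) - (F 1 - F 0)) < e"
  proof (intro exI[of _ "Suc n0"] allI impI)
    fix n assume n: "Suc n0 \<le> n"
    have np: "real n > 0" using n by simp
    have "1 / d < real n" using n0 n by simp
    then have nd: "1 / real n < d" using np d(1) by (simp add: field_simps)
    have step: "\<bar>h (real (Suc i) / real n) / real n - (F (real (Suc i) / real n) - F (real i / real n))\<bar>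
        \<le> e / 2 / real n" if i: "i < n" for i
    proof -
      define x y where "x = real i / real n" and "y = real (Suc i) / real n"
      have yx: "y - x = 1 / real n" by (simp add: x_def y_def add_divide_distrib)
      have xy: "0 \<le> x" "x < y" "y \<le> 1"
        using i np by (auto simp: x_def y_def divide_strict_right_mono)
      have "\<exists>l z. x < z \<and> z < y \<and> (F has_field_derivative l) (at z) \<and> F y - F x = (y - x) * l"
      proof (rule MVT)
        show "continuous_on {x..y} F" using xy by (intro continuous_on_subset[OF F]) auto
        show "F differentiable at z" if "x < z" "z < y" for z
          using D[of z] that xy unfolding real_differentiable_def by fastforce
      qed (fact xy(2))
      then obtain l z where z: "x < z" "z < y" "(F has_field_derivative l) (at z)" "F y - F x = (y - x) * l"
        by blast
      have "l = h z" using DERIV_unique[OF z(3) D[of z]] z xy by simp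
      then have "F y - F x = h z / real n" using z(4) yx by simp
      then have "h y / real n - (F y - F x) = (h y - h z) / real n" by (simp add: diff_divide_distrib)
      moreover have "\<bar>h y - h z\<bar> \<le> e / 2"
        using d(2)[of z y] z xy nd yx by (simp add: dist_real_def)
      ultimately show ?thesis
        unfolding x_def[symmetric] y_def[symmetric] using np
        by (simp only: abs_divide abs_of_pos[OF np] divide_right_mono less_imp_le)
    qed
    have "(\<Sum>i<n. F (real (Suc i) / real n) - F (real i / real n)) = F 1 - F 0"
      using sum_lessThan_telescope[of "\<lambda>i. F (real i / real n)" n] np by simp
    then have "(\<Sum>i<n. h (real (Suc i) / real n) / real n) - (F 1 - F 0)
      = (\<Sum>i<n. h (real (Suc i) / real n) / real n - (F (real (Suc i) / real n) - F (real i / real n)))"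
      by (simp only: sum_subtractf)
    also have "\<bar>\<dots>\<bar> \<le> (\<Sum>i<n. e / 2 / real n)"
      by (rule order_trans[OF sum_abs sum_mono]) (use step in simp)
    also have "\<dots> = e / 2" using np by simp
    finally show "norm ((\<Sum>i<n. h (real (Suc i) / real n) / real n) - (F 1 - F 0)) < e"
      using e by simp
  qed
qed

locale pos_form =
  fixes a b c :: real
  assumes a_pos: "a > 0" and c_pos: "c > 0" and disc: "b\<^sup>2 < 4 * a * c"
begin

definition rt :: real where "rt = sqrt (4 * a * c - b\<^sup>2)"

definition Q :: "real \<Rightarrow> real \<Rightarrow> real" where "Q x y = a * x\<^sup>2 + b * x * y + c * y\<^sup>2"

text \<open>With \<open>mu\<close> the root \<open>(- b + i * rt) / (2 * c)\<close> defined further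
  down, this is the angle \<open>- Arg (1 - t * mu)\<close> for positive \<open>t\<close>, and also
  \<open>rt / 2\<close> times the integral of \<open>1 / Q s 1\<close> over \<open>[0, t]\<close>.
  The difference of two arctangents is smooth for all \<open>t\<close> and needs no choice of
  branch.\<close>

definition beta :: "real \<Rightarrow> real" where
  "beta t = arctan ((2 * a * t + b) / rt) - arctan (b / rt)"

definition gam :: "real \<Rightarrow> real" where
  "gam t = pi / 2 - arctan ((2 * a * t + b) / rt)"

text \<open>The value at 0 is the derivative of \<open>beta\<close> there, which makes the quotient
  continuous. It is the integrand of the imaginary part of the dilogarithm.\<close>

definition beta_quot :: "real \<Rightarrow> real" where
  "beta_quot t = (if t = 0 then rt / (2 * c) else beta t / t)"

text \<open>This is \<open>Im (Li\<^sub>2 (t \<mu>))\<close>, written by means of the Bloch--Wigner function.\<close>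

definition dilog :: "real \<Rightarrow> real" where
  "dilog t = (Cl2 (pi + 2 * arctan (b / rt)) + Cl2 (2 * beta t) + Cl2 (2 * gam t)) / 2
     + beta t * ln (t * sqrt (a / c))"

lemma rt_pos: "rt > 0"
  using disc by (simp add: rt_def)

lemma rt_square: "rt\<^sup>2 = 4 * a * c - b\<^sup>2"
  using disc by (simp add: rt_def)

lemma four_a_Q: "4 * a * Q x y = (2 * a * x + b * y)\<^sup>2 + rt\<^sup>2 * y\<^sup>2"
  unfolding rt_square Q_def by (simp add: power2_eq_square algebra_simps)

lemma Q_pos: 
  assumes "x \<noteq> 0 \<or> y \<noteq> 0"
  shows "Q x y > 0"
proof -
  have "(2 * a * x + b * y)\<^sup>2 + rt\<^sup>2 * y\<^sup>2 > 0"
  proof (cases "y = 0")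
    case True
    then show ?thesis using assms a_pos by simp
  next
    case False
    then show ?thesis using rt_pos by (intro add_nonneg_pos mult_pos_pos) auto
  qed
  then have "4 * a * Q x y > 0" by (simp only: four_a_Q)
  then show ?thesis using a_pos by (simp add: zero_less_mult_iff)
qed

lemma Q_t1_pos: "Q t 1 > 0" by (rule Q_pos) simp

lemma Q_scale: "Q (s * x) (s * y) = s\<^sup>2 * Q x y"
  by (simp add: Q_def power2_eq_square algebra_simps)

lemma beta_0 [simp]: "beta 0 = 0"
  by (simp add: beta_def)

lemma beta_deriv: "(beta has_field_derivative rt / (2 * Q t 1)) (at t within A)"
proof -
  define u where "u = (2 * a * t + b) / rt"
  have "1 + u\<^sup>2 = 4 * a * Q t 1 / rt\<^sup>2"
    using four_a_Q[of t 1] rt_pos by (simp add: u_def power_divide field_simps)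
  then have e: "2 * a / rt / (1 + u\<^sup>2) = rt / (2 * Q t 1)"
    using rt_pos a_pos Q_t1_pos[of t] by (simp only:) (simp add: field_simps power2_eq_square)
  have "(beta has_field_derivative inverse (1 + u\<^sup>2) * (2 * a / rt)) (at t within A)"
    unfolding beta_def[abs_def] u_def using rt_pos
    by (auto intro!: derivative_eq_intros)
  also have "inverse (1 + u\<^sup>2) * (2 * a / rt) = rt / (2 * Q t 1)"
    unfolding e[symmetric] divide_inverse[of _ "1 + u\<^sup>2"] by (rule mult.commute)
  finally show ?thesis .
qed

lemma gam_eq: "gam t = pi / 2 - arctan (b / rt) - beta t"
  by (simp add: gam_def beta_def)

lemma beta_bounds:
  assumes "t > 0"
  shows "beta t > 0" "beta t < pi"
proof -
  have "b / rt < (2 * a * t + b) / rt"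
    using assms a_pos rt_pos by (intro divide_strict_right_mono) auto
  then show "beta t > 0" by (simp add: beta_def arctan_less_iff)
  show "beta t < pi"
    using arctan_ubound[of "(2 * a * t + b) / rt"] arctan_lbound[of "b / rt"]
    by (simp add: beta_def)
qed

lemma gam_bounds: "gam t > 0" "gam t < pi"
  using arctan_ubound[of "(2 * a * t + b) / rt"] arctan_lbound[of "(2 * a * t + b) / rt"]
  by (simp_all add: gam_def)

lemma sin_gam_pos: "sin (gam t) > 0"
  using gam_bounds by (rule sin_gt_zero)

text \<open>The law of sines in the triangle with vertices \<open>0\<close>, \<open>1\<close> and \<open>t \<mu>\<close>, whose angles at \<open>1\<close>
  and at \<open>t \<mu>\<close> are \<open>beta t\<close> and \<open>gam t\<close>.\<close>

lemma sin_beta: "sin (beta t) = t * sqrt (a / c) * sin (gam t)"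
proof -
  define u v where "u = (2 * a * t + b) / rt" and "v = b / rt"
  have p: "sqrt (1 + u\<^sup>2) > 0" "sqrt (1 + v\<^sup>2) > 0" by (auto intro: add_pos_nonneg)
  have s: "sin (gam t) = 1 / sqrt (1 + u\<^sup>2)"
    by (simp add: gam_def u_def[symmetric] sin_diff cos_arctan)
  have "sin (beta t) = (u - v) / sqrt (1 + v\<^sup>2) / sqrt (1 + u\<^sup>2)"
  proof -
    have "beta t = arctan u - arctan v" by (simp only: beta_def u_def v_def)
    show ?thesis
      unfolding \<open>beta t = arctan u - arctan v\<close> sin_diff sin_arctan cos_arctan
      by (simp add: diff_divide_distrib mult.commute)
  qed
  moreover have "(u - v) / sqrt (1 + v\<^sup>2) = t * sqrt (a / c)"
  proof -
    have "1 + v\<^sup>2 = 4 * (a * c) / rt\<^sup>2"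
      using rt_pos rt_square by (simp add: v_def power_divide field_simps)
    then have "sqrt (1 + v\<^sup>2) = 2 * sqrt (a * c) / rt"
      using rt_pos by (simp add: real_sqrt_divide real_sqrt_mult)
    moreover have "u - v = 2 * a * t / rt" by (simp add: u_def v_def add_divide_distrib)
    ultimately have "(u - v) / sqrt (1 + v\<^sup>2) = t * (a / sqrt (a * c))"
      using rt_pos by simp
    also have "a / sqrt (a * c) = sqrt (a / c)"
      using a_pos c_pos by (simp add: real_sqrt_divide real_sqrt_mult field_simps)
    finally show ?thesis .
  qed
  ultimately show ?thesis by (simp add: s)
qed

text \<open>Since \<open>gam\<close> and \<open>beta\<close> have opposite derivatives, the Clausen
  terms contribute the derivative of \<open>beta\<close> times
  \<open>ln (sin (gam t) / sin (beta t))\<close>. By the law of sines this cancels the term in which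
  the product rule differentiates \<open>beta\<close>, and only \<open>beta t / t\<close>
  survives.\<close>

lemma dilog_deriv:
  assumes t: "t > 0"
  shows "(dilog has_field_derivative beta_quot t) (at t)"
proof -
  define D where "D = rt / (2 * Q t 1)"
  define s where "s = sqrt (a / c)"
  have sp: "s > 0" using a_pos c_pos by (simp add: s_def)
  have b: "(beta has_field_derivative D) (at t)" unfolding D_def by (rule beta_deriv)
  have g: "(gam has_field_derivative - D) (at t)"
    unfolding gam_eq[abs_def] by (auto intro!: derivative_eq_intros b)
  have cb: "((\<lambda>t. Cl2 (2 * beta t)) has_field_derivative - ln (2 * sin (beta t)) * (2 * D)) (at t)"
    using DERIV_chain2[OF DERIV_Cl2[of "2 * beta t"] DERIV_cmult[OF b, of 2]] beta_bounds[OF t] by simp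
  have cg: "((\<lambda>t. Cl2 (2 * gam t)) has_field_derivative - ln (2 * sin (gam t)) * (2 * - D)) (at t)"
    using DERIV_chain2[OF DERIV_Cl2[of "2 * gam t"] DERIV_cmult[OF g, of 2]] gam_bounds[of t] by simp
  have l: "((\<lambda>t. ln (t * s)) has_field_derivative 1 / t) (at t)"
    using t sp by (auto intro!: derivative_eq_intros)
  have "(dilog has_field_derivative (0 + - ln (2 * sin (beta t)) * (2 * D) + - ln (2 * sin (gam t)) * (2 * - D)) / 2
    + (D * ln (t * s) + 1 / t * beta t)) (at t)"
    unfolding dilog_def[abs_def] s_def[symmetric]
    by (intro DERIV_add DERIV_cdivide DERIV_const cb cg DERIV_mult[OF b l])
  moreover have "ln (2 * sin (beta t)) = ln (2 * sin (gam t)) + ln (t * s)"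
  proof -
    have "2 * sin (beta t) = (2 * sin (gam t)) * (t * s)" by (simp add: sin_beta s_def)
    moreover have "2 * sin (gam t) > 0" "t * s > 0" using sin_gam_pos[of t] t sp by simp_all
    ultimately show ?thesis by (simp only: ln_mult_pos)
  qed
  ultimately show ?thesis using t by (simp add: beta_quot_def algebra_simps)
qed

lemma continuous_on_beta: "continuous_on A beta"
  by (rule DERIV_continuous_on, rule beta_deriv)

lemma continuous_on_row: "continuous_on A beta_quot"
proof (rule continuous_on_subset[OF _ subset_UNIV], rule continuous_at_imp_continuous_on, rule ballI)
  fix t :: real
  show "isCont beta_quot t"
  proof (cases "t = 0")
    case True
    have "((\<lambda>h. (beta (0 + h) - beta 0) / h) \<longlongrightarrow> rt / (2 * Q 0 1)) (at 0)"
      using beta_deriv[of 0 UNIV] by (simp only: DERIV_def)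
    then have "((\<lambda>h. beta h / h) \<longlongrightarrow> rt / (2 * c)) (at 0)" by (simp add: Q_def)
    moreover have "\<forall>\<^sub>F h in at 0. beta h / h = beta_quot h"
      by (simp add: beta_quot_def eventually_at_filter)
    ultimately have "(beta_quot \<longlongrightarrow> rt / (2 * c)) (at 0)" by (rule Lim_transform_eventually)
    then show ?thesis using True by (simp add: isCont_def beta_quot_def)
  next
    case False
    have "isCont (\<lambda>t. beta t / t) t"
      using False continuous_on_beta[of UNIV] by (auto simp: continuous_on_eq_continuous_at)
    moreover have "\<forall>\<^sub>F h in nhds t. beta h / h = beta_quot h"
      using t1_space_nhds[OF False] by eventually_elim (simp add: beta_quot_def)
    ultimately show ?thesis using isCont_cong[of "\<lambda>t. beta t / t" beta_quot t] by simp
  qed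
qed

lemma beta_eq_row: "beta t = beta_quot t * t"
  by (simp add: beta_quot_def)

text \<open>The triangle degenerates: the angles at 0 and at \<open>t * mu\<close> become
  supplementary, so their Clausen values cancel, and the logarithmic term dies with
  \<open>beta 0\<close>.\<close>

lemma dilog_0: "dilog 0 = 0"
  using Cl2_reflect[of "pi + 2 * arctan (b / rt)"] by (simp add: dilog_def gam_def algebra_simps)

lemma continuous_on_dilog: "continuous_on {0..1} dilog"
proof -
  define s where "s = sqrt (a / c)"
  have sp: "s > 0" using a_pos c_pos by (simp add: s_def)
  have cl: "continuous_on {0..1::real} (\<lambda>t. t * ln (t * s))"
  proof (rule continuous_on_eq_continuous_within[THEN iffD2], rule ballI)
    fix t :: real assume "t \<in> {0..1}"
    then consider "t = 0" | "t > 0" by fastforce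
    then show "continuous (at t within {0..1}) (\<lambda>t. t * ln (t * s))"
    proof cases
      case 1
      have "((\<lambda>t. t * ln (t * s)) \<longlongrightarrow> 0) (at_right 0)" using sp by real_asymp
      moreover have "at (0::real) within {0..1} = at_right 0"
        by (rule at_within_Icc_at_right) simp
      ultimately show ?thesis using 1 by (simp add: continuous_within)
    next
      case 2
      then show ?thesis using sp by (intro continuous_intros) auto
    qed
  qed
  have cb: "continuous_on {0..1} (\<lambda>t. Cl2 (2 * beta t))" "continuous_on {0..1} (\<lambda>t. Cl2 (2 * gam t))"
    unfolding gam_eq
    by (rule continuous_on_compose2[OF continuous_on_Cl2[of UNIV]];
        auto intro!: continuous_intros continuous_on_beta)+
  \<comment> \<open>Moving a factor \<open>t\<close> from \<open>beta t\<close> to the logarithm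
    leaves \<open>t * ln (t * s)\<close>, which is continuous at 0.\<close>
  have "dilog = (\<lambda>t. (Cl2 (pi + 2 * arctan (b / rt)) + Cl2 (2 * beta t) + Cl2 (2 * gam t)) / 2
     + beta_quot t * (t * ln (t * s)))"
    by (simp add: fun_eq_iff dilog_def s_def beta_eq_row)
  then show ?thesis
    by (simp only:) (intro continuous_intros cb cl continuous_on_row; simp)
qed

lemma row_riemann_sum:
  "(\<lambda>n. \<Sum>i<n. beta_quot (real (Suc i) / real n) / real n) \<longlonglongrightarrow> dilog 1"
  using right_riemann_sum_tendsto[OF continuous_on_dilog continuous_on_row dilog_deriv]
  by (simp add: dilog_0)

text \<open>Combining the two arctangents brings out \<open>2 * c + b\<close>, the form in which
  this angle occurs in \<open>clausen_C\<close>.\<close>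

lemma beta_1: "beta 1 = pi / 2 - arctan ((2 * c + b) / rt)"
proof -
  define u v where "u = (2 * a + b) / rt" and "v = - b / rt"
  have uv: "u + v = 2 * a / rt" by (simp add: u_def v_def flip: add_divide_distrib diff_divide_distrib)
  have "1 - u * v = (rt\<^sup>2 + (2 * a + b) * b) / rt\<^sup>2"
    using rt_pos by (simp add: u_def v_def field_simps power2_eq_square)
  also have "rt\<^sup>2 + (2 * a + b) * b = 2 * a * (2 * c + b)"
    unfolding rt_square by (simp add: algebra_simps power2_eq_square)
  finally have "(1 - u * v) / (u + v) = (2 * c + b) / rt"
    using uv rt_pos a_pos by (simp add: power2_eq_square)
  moreover have "beta 1 = arctan u + arctan v" by (simp add: beta_def u_def v_def arctan_minus)
  moreover have "u + v > 0" using uv rt_pos a_pos by simp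
  ultimately show ?thesis using arctan_add_pos[of u v] by simp
qed

lemma dilog_1: "dilog 1 = (Cl2 (pi + 2 * arctan (b / rt)) + Cl2 (pi - 2 * arctan ((2 * c + b) / rt))
    + Cl2 (pi - 2 * arctan ((2 * a + b) / rt))) / 2 - beta 1 * ln (c / a) / 2"
proof -
  have "2 * beta 1 = pi - 2 * arctan ((2 * c + b) / rt)" by (simp add: beta_1)
  moreover have "2 * gam 1 = pi - 2 * arctan ((2 * a + b) / rt)" by (simp add: gam_def)
  moreover have "ln (1 * sqrt (a / c)) = - ln (c / a) / 2"
    using a_pos c_pos by (simp add: ln_sqrt ln_div)
  ultimately show ?thesis unfolding dilog_def by simp
qed

end


section \<open>Partial fractions of the cotangent and the eta function\<close>

lemma sin_nonzero_upper_half_plane: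
  assumes "Im z > 0"
  shows "sin (of_real pi * z) \<noteq> (0 :: complex)"
proof
  assume "sin (of_real pi * z) = (0 :: complex)"
  then obtain n :: int where "of_real pi * z = of_real (of_int n * pi)"
    unfolding sin_eq_0 by auto
  then have "Im (of_real pi * z) = Im (of_real (of_int n * pi))" by simp
  then show False using assms by simp
qed

text \<open>Logarithmic differentiation of the reflection formula
  \<open>Gamma z * Gamma (1 - z) = pi / sin (pi * z)\<close>.\<close>

lemma Digamma_reflection:
  assumes "Im z > 0"
  shows "Digamma (1 - z) - Digamma z = of_real pi * cos (of_real pi * z) / sin (of_real pi * z :: complex)"
proof -
  have nz: "z \<notin> \<int>\<^sub>\<le>\<^sub>0" "1 - z \<notin> \<int>\<^sub>\<le>\<^sub>0"
    using assms by (auto elim!: nonpos_Ints_cases simp: complex_eq_iff)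
  define S C G where "S = sin (of_real pi * z)" and "C = cos (of_real pi * z)"
    and "G = Gamma z * Gamma (1 - z)"
  have S: "S \<noteq> 0" using sin_nonzero_upper_half_plane[OF assms] by (simp add: S_def)
  have "((\<lambda>z. Gamma z * Gamma (1 - z)) has_field_derivative G * (Digamma z - Digamma (1 - z))) (at z)"
    using nz by (auto intro!: derivative_eq_intros simp: G_def algebra_simps)
  moreover have "((\<lambda>z. of_real pi / sin (of_real pi * z)) has_field_derivative
      - (of_real pi * of_real pi * C) / (S * S)) (at z)"
    using S by (auto intro!: derivative_eq_intros simp: S_def C_def)
  ultimately have "G * (Digamma z - Digamma (1 - z)) = - (of_real pi * of_real pi * C) / (S * S)"
    unfolding Gamma_reflection_complex by (rule DERIV_unique)
  moreover have "G = of_real pi / S" unfolding G_def S_def by (rule Gamma_reflection_complex)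
  ultimately have "of_real pi / S * (Digamma z - Digamma (1 - z)) = of_real pi / S * (- (of_real pi * C) / S)"
    by (simp only:) (simp only: times_divide_times_eq mult_minus_right mult.assoc)
  moreover have "of_real pi / S \<noteq> 0" using S by simp
  ultimately have "Digamma z - Digamma (1 - z) = - (of_real pi * C) / S"
    using mult_left_cancel by blast
  moreover have "Digamma (1 - z) - Digamma z = - (Digamma z - Digamma (1 - z))" by simp
  ultimately show ?thesis by (simp add: S_def C_def del: minus_diff_eq)
qed

lemma cot_eq_exp:
  assumes "exp (2 * of_real pi * \<i> * z) \<noteq> 1"
  shows "cos (of_real pi * z) / sin (of_real pi * z)
    = - \<i> * ((1 + exp (2 * of_real pi * \<i> * z)) / (1 - exp (2 * of_real pi * \<i> * z)))"
proof -
  define E where "E = exp (\<i> * (of_real pi * z))"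
  have q: "exp (2 * of_real pi * \<i> * z) = E * E"
    unfolding E_def exp_add[symmetric] by (simp add: algebra_simps)
  have i: "exp (- (\<i> * (of_real pi * z))) = 1 / E" by (simp add: E_def exp_minus divide_inverse)
  have E: "E \<noteq> 0" by (simp add: E_def)
  have EE: "E * E \<noteq> 1" using assms q by simp
  have c: "cos (of_real pi * z) = (E * E + 1) / (2 * E)"
    unfolding cos_exp_eq i E_def[symmetric] using E by (simp add: field_simps)
  have s: "sin (of_real pi * z) = (E * E - 1) / (2 * \<i> * E)"
    unfolding sin_exp_eq i E_def[symmetric] using E by (simp add: field_simps)
  have "cos (of_real pi * z) / sin (of_real pi * z) = \<i> * ((E * E + 1) / (E * E - 1))"
    unfolding c s using E EE by (simp add: field_simps)
  also have "(E * E + 1) / (E * E - 1) = - ((1 + E * E) / (1 - E * E))"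
    using EE by (simp add: field_simps)
  also have "\<i> * - ((1 + E * E) / (1 - E * E)) = - \<i> * ((1 + E * E) / (1 - E * E))"
    by (simp only: mult_minus_left mult_minus_right)
  finally show ?thesis unfolding q .
qed

lemma norm_exp_2pi_i:
  assumes "Im z > 0"
  shows "cmod (exp (2 * of_real pi * \<i> * z)) < 1"
  using assms by simp

lemma Im_inverse: "Im (inverse z) = - Im z / (cmod z)\<^sup>2"
  by (simp add: cmod_power2)

text \<open>Up to the factor \<open>- Im z\<close>, the summands are imaginary parts of
  \<open>1 / (z + k)\<close>, \<open>k\<close> an integer, so this is the imaginary part of the
  partial fractions of the cotangent. Writing these as a difference of two Digamma limits cancels
  the divergent \<open>ln (real m)\<close>.\<close>

lemma lattice_row_sum:
  assumes "Im z > 0"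
  defines "q \<equiv> exp (2 * of_real pi * \<i> * z)"
  shows "(\<lambda>m. \<Sum>n<m. 1 / (cmod (z + of_nat n))\<^sup>2 + 1 / (cmod (z - of_nat (Suc n)))\<^sup>2)
    \<longlonglongrightarrow> pi / Im z * Re ((1 + q) / (1 - q))"
proof -
  have q1: "q \<noteq> 1" using norm_exp_2pi_i[OF assms(1)] unfolding q_def by fastforce
  have z: "z \<noteq> 0" "1 - z \<noteq> 0" using assms(1) by auto
  have "(\<lambda>m. (of_real (ln (real m)) - (\<Sum>n<m. inverse ((1 - z) + of_nat n)))
      - (of_real (ln (real m)) - (\<Sum>n<m. inverse (z + of_nat n))))
      \<longlonglongrightarrow> Digamma (1 - z) - Digamma z"
    by (intro tendsto_diff Digamma_LIMSEQ z)
  then have "(\<lambda>m. Im ((\<Sum>n<m. inverse (z + of_nat n)) - (\<Sum>n<m. inverse ((1 - z) + of_nat n))))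
      \<longlonglongrightarrow> Im (Digamma (1 - z) - Digamma z)"
    by (intro tendsto_Im) (simp add: algebra_simps)
  moreover have "Im (Digamma (1 - z) - Digamma z) = - pi * Re ((1 + q) / (1 - q))"
  proof -
    have "Digamma (1 - z) - Digamma z = of_real pi * (- \<i> * ((1 + q) / (1 - q)))"
      unfolding Digamma_reflection[OF assms(1)]
      using cot_eq_exp[of z, folded q_def, OF q1] by (simp only: times_divide_eq_right[symmetric])
    moreover have "Im (of_real pi * (- \<i> * w)) = - pi * Re w" for w by simp
    ultimately show ?thesis by (simp only:)
  qed
  moreover have "Im ((\<Sum>n<m. inverse (z + of_nat n)) - (\<Sum>n<m. inverse ((1 - z) + of_nat n)))
    = - Im z * (\<Sum>n<m. 1 / (cmod (z + of_nat n))\<^sup>2 + 1 / (cmod (z - of_nat (Suc n)))\<^sup>2)" for m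
  proof -
    have "cmod ((1 - z) + of_nat n) = cmod (z - of_nat (Suc n))" for n
      using norm_minus_cancel[of "(1 - z) + of_nat n"] by (simp add: algebra_simps)
    then have "Im (inverse (z + of_nat n)) - Im (inverse ((1 - z) + of_nat n))
      = - Im z * (1 / (cmod (z + of_nat n))\<^sup>2 + 1 / (cmod (z - of_nat (Suc n)))\<^sup>2)" for n
      unfolding Im_inverse by (simp add: field_simps)
    then show ?thesis
      unfolding minus_complex.sel Im_sum sum_subtractf[symmetric] sum_distrib_left by simp
  qed
  ultimately have "(\<lambda>m. - Im z * (\<Sum>n<m. 1 / (cmod (z + of_nat n))\<^sup>2 + 1 / (cmod (z - of_nat (Suc n)))\<^sup>2))
     \<longlonglongrightarrow> - pi * Re ((1 + q) / (1 - q))" by simp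
  from tendsto_mult_left[OF this, of "- 1 / Im z"] show ?thesis
    using assms(1) by simp
qed

text \<open>Expand each \<open>- ln (1 - q ^ Suc k)\<close> as a power series and sum over
  \<open>k\<close> first: for fixed \<open>j\<close> that is a geometric series. The majorant
  \<open>M\<close> justifies the exchange by Tannery's theorem. Nonvanishing of the product is what
  allows its logarithm to be taken as a limit.\<close>

lemma lambert_log_product:
  fixes q :: complex
  assumes q: "cmod q < 1"
  shows "(\<lambda>n. \<Sum>j<n. Re (q ^ Suc j / (1 - q ^ Suc j)) / real (Suc j))
     \<longlonglongrightarrow> - ln (cmod (\<Prod>k. 1 - q ^ Suc k))"
    and "(\<Prod>k. 1 - q ^ Suc k) \<noteq> 0"
proof -
  define P where "P = (\<Prod>k. 1 - q ^ Suc k)"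
  have qn: "cmod (q ^ Suc k) < 1" for k
    using q power_Suc_le_self[of "cmod q" k] unfolding norm_power by simp
  have q1: "1 - q ^ Suc k \<noteq> 0" for k using qn[of k] by fastforce
  have sq: "summable (\<lambda>k. cmod q ^ Suc k)" using q summable_geometric[of "cmod q"]
    by (subst summable_Suc_iff) simp
  have "convergent_prod (\<lambda>k. 1 - q ^ Suc k)"
    by (intro abs_convergent_prod_imp_convergent_prod summable_imp_abs_convergent_prod)
      (use sq in \<open>simp add: norm_power norm_mult\<close>)
  then have hp: "(\<lambda>k. 1 - q ^ Suc k) has_prod P"
    unfolding P_def by (rule convergent_prod_has_prod)
  then have P: "(\<lambda>n. \<Prod>k<n. 1 - q ^ Suc k) \<longlonglongrightarrow> P" by (rule has_prod_imp_tendsto')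
  have P0: "P \<noteq> 0" using has_prod_eq_0_iff[OF hp] q1 by (simp only: image_iff) metis
  show "(\<Prod>k. 1 - q ^ Suc k) \<noteq> 0" using P0 by (simp add: P_def)
  have lnP: "(\<lambda>n. \<Sum>k<n. ln (cmod (1 - q ^ Suc k))) \<longlonglongrightarrow> ln (cmod P)"
  proof -
    have "(\<lambda>n. ln (cmod (\<Prod>k<n. 1 - q ^ Suc k))) \<longlonglongrightarrow> ln (cmod P)"
      using P P0 by (intro tendsto_ln tendsto_norm) auto
    moreover have "ln (cmod (\<Prod>k<n. 1 - q ^ Suc k)) = (\<Sum>k<n. ln (cmod (1 - q ^ Suc k)))" for n
      unfolding prod_norm[symmetric] using q1 by (intro ln_prod) auto
    ultimately show ?thesis by simp
  qed
  define g where "g k j = (q ^ Suc k) ^ Suc j / of_nat (Suc j)" for k j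
  define M where "M j = cmod q ^ Suc j * (1 / (1 - cmod q))" for j
  have gsum: "(\<lambda>j. g k j) sums (- ln (1 - q ^ Suc k))" for k
  proof -
    have "(\<lambda>j. - (- ((- (- (q ^ Suc k))) ^ j / of_nat j))) sums (- ln (1 + (- (q ^ Suc k))))"
      using sums_minus[OF Ln_series'[of "- (q ^ Suc k)"]] qn[of k] by simp
    then have "(\<lambda>j. (q ^ Suc k) ^ j / of_nat j) sums (- ln (1 - q ^ Suc k))"
      by (simp only: minus_minus diff_conv_add_uminus)
    then show ?thesis
      unfolding g_def sums_Suc_iff[of "\<lambda>j. (q ^ Suc k) ^ j / of_nat j"] by simp
  qed
  \<comment> \<open>The exponent is the product of \<open>Suc k\<close> and \<open>Suc j\<close>;
    read the other way round, the term is geometric in \<open>k\<close>.\<close>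
  have gcomm: "g k j = q ^ Suc j * (q ^ Suc j) ^ k / of_nat (Suc j)" for k j
  proof -
    have "(q ^ Suc k) ^ Suc j = (q ^ Suc j) ^ Suc k"
      unfolding power_mult[symmetric] by (simp only: mult.commute)
    then show ?thesis unfolding g_def by (simp only: power_Suc[of "q ^ Suc j"])
  qed
  have col: "(\<lambda>n. \<Sum>k<n. g k j) \<longlonglongrightarrow> q ^ Suc j / (1 - q ^ Suc j) / of_nat (Suc j)" for j
  proof -
    have "(\<lambda>k. (q ^ Suc j) ^ k) sums (1 / (1 - q ^ Suc j))"
      by (rule geometric_sums[OF qn])
    from sums_divide[OF sums_mult[OF this, of "q ^ Suc j"], of "of_nat (Suc j)"]
    show ?thesis unfolding gcomm sums_def by simp
  qed
  have bound: "norm (\<Sum>k<n. g k j) \<le> M j" for n j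
  proof -
    have "norm (\<Sum>k<n. g k j) \<le> (\<Sum>k<n. norm (g k j))" by (rule norm_sum)
    also have "\<dots> \<le> (\<Sum>k<n. cmod q ^ Suc j * cmod q ^ k)"
    proof (rule sum_mono)
      fix k
      have "norm (g k j) = cmod q ^ Suc j * (cmod q ^ Suc j) ^ k / real (Suc j)"
        unfolding gcomm by (simp add: norm_mult norm_divide norm_power del: of_nat_Suc)
      also have "\<dots> \<le> cmod q ^ Suc j * (cmod q ^ Suc j) ^ k / 1"
        by (intro divide_left_mono) auto
      also have "\<dots> \<le> cmod q ^ Suc j * cmod q ^ k"
      proof -
        have "cmod q ^ Suc j \<le> cmod q"
          using q power_decreasing[of 1 "Suc j" "cmod q"] by simp
        then show ?thesis by (simp add: mult_left_mono power_mono)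
      qed
      finally show "norm (g k j) \<le> cmod q ^ Suc j * cmod q ^ k" .
    qed
    also have "\<dots> = cmod q ^ Suc j * (\<Sum>k<n. cmod q ^ k)" by (simp only: sum_distrib_left)
    also have "\<dots> \<le> M j"
      unfolding M_def
    proof (rule mult_left_mono)
      show "(\<Sum>k<n. cmod q ^ k) \<le> 1 / (1 - cmod q)"
        using sum_le_suminf[of "\<lambda>k. cmod q ^ k" "{..<n}"] q
        by (simp add: summable_geometric suminf_geometric)
    qed simp
    finally show ?thesis .
  qed
  have sM: "summable M" unfolding M_def by (rule summable_mult2[OF sq])
  have ev: "\<forall>\<^sub>F (j, n) in sequentially \<times>\<^sub>F sequentially. norm (\<Sum>k<n. g k j) \<le> M j"
    unfolding case_prod_beta by (rule always_eventually, rule allI, rule bound)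
  define B where "B j = q ^ Suc j / (1 - q ^ Suc j) / of_nat (Suc j)" for j
  have T: "summable (\<lambda>j. norm (B j))" "(\<lambda>n. \<Sum>j. \<Sum>k<n. g k j) \<longlonglongrightarrow> suminf B"
    using tannerys_theorem[of "\<lambda>j n. \<Sum>k<n. g k j" B sequentially M, OF _ ev sM] col
    unfolding B_def by simp_all
  have "(\<Sum>j. \<Sum>k<n. g k j) = (\<Sum>k<n. - ln (1 - q ^ Suc k))" for n
    using gsum by (subst suminf_sum) (auto simp: sums_iff)
  then have "(\<lambda>n. Re (\<Sum>k<n. - ln (1 - q ^ Suc k))) \<longlonglongrightarrow> Re (suminf B)"
    using T(2) by (intro tendsto_Re) simp
  moreover have "Re (\<Sum>k<n. - ln (1 - q ^ Suc k)) = - (\<Sum>k<n. ln (cmod (1 - q ^ Suc k)))" for n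
  proof -
    have "Re (ln (1 - q ^ Suc k)) = ln (cmod (1 - q ^ Suc k))" for k
      using q1 by (rule Re_Ln)
    then show ?thesis by (simp only: Re_sum uminus_complex.sel sum_negf)
  qed
  ultimately have "Re (suminf B) = - ln (cmod P)"
    using tendsto_minus[OF lnP] LIMSEQ_unique by simp
  moreover have "B sums suminf B" using summable_norm_cancel[OF T(1)] by (rule summable_sums)
  ultimately have "(\<lambda>j. Re (B j)) sums (- ln (cmod P))" using sums_Re by metis
  moreover have "Re (B j) = Re (q ^ Suc j / (1 - q ^ Suc j)) / real (Suc j)" for j
    unfolding B_def by (rule Re_divide_of_nat)
  ultimately show "(\<lambda>n. \<Sum>j<n. Re (q ^ Suc j / (1 - q ^ Suc j)) / real (Suc j))
     \<longlonglongrightarrow> - ln (cmod (\<Prod>k. 1 - q ^ Suc k))"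
    by (simp only: sums_def P_def)
qed

lemma ln_norm_dedekind_eta:
  assumes "Im \<tau> > 0"
  shows "ln (cmod (dedekind_eta \<tau>)) = - pi * Im \<tau> / 12
     + ln (cmod (\<Prod>k. 1 - exp (2 * of_real pi * \<i> * \<tau>) ^ Suc k))"
proof -
  define q where "q = exp (2 * of_real pi * \<i> * \<tau>)"
  have "exp (2 * of_real pi * \<i> * of_nat (k + 1) * \<tau>) = q ^ Suc k" for k
    unfolding q_def exp_of_nat_mult[symmetric] by (simp add: mult_ac)
  then have "dedekind_eta \<tau> = exp (of_real pi * \<i> * \<tau> / 12) * (\<Prod>k. 1 - q ^ Suc k)"
    by (simp only: dedekind_eta_def)
  moreover have "(\<Prod>k. 1 - q ^ Suc k) \<noteq> 0"
    using norm_exp_2pi_i[OF assms] unfolding q_def by (rule lambert_log_product(2))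
  ultimately show ?thesis
    unfolding q_def[symmetric] by (simp add: norm_mult ln_mult)
qed


section \<open>Trapezoidal sums along a side\<close>

text \<open>Here \<open>D 1\<close> is the integrand, \<open>D 0\<close> an antiderivative and
  \<open>D 2\<close> its first derivative. Taylor expansion of all three at \<open>x\<close> cancels
  everything up to \<open>D 4\<close>; fifth derivatives remain, with weights 1/48, 1/120 and 1/72,
  whose sum is below 1.\<close>

lemma trapezoid_step:
  fixes D :: "nat \<Rightarrow> real \<Rightarrow> real"
  assumes D: "\<And>m t. m < 5 \<Longrightarrow> x \<le> t \<Longrightarrow> t \<le> x + h \<Longrightarrow> (D m has_field_derivative D (Suc m) t) (at t)"
    and M: "\<And>t. x \<le> t \<Longrightarrow> t \<le> x + h \<Longrightarrow> \<bar>D 5 t\<bar> \<le> M" and h: "h > 0"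
  shows "\<bar>h * (D 1 x + D 1 (x + h)) / 2 - (D 0 (x + h) - D 0 x) - h\<^sup>2 / 12 * (D 2 (x + h) - D 2 x)\<bar> \<le> M * h ^ 5"
proof -
  have T: "\<exists>t. x < t \<and> t < x + h \<and> D i (x + h) = (\<Sum>m<n. (D (m + i) x / fact m) * h ^ m) + D (n + i) t / fact n * h ^ n"
    if "n > 0" "n + i = 5" for n i
    using Taylor_up[of n "\<lambda>m. D (m + i)" "D i" x "x + h" x] that D h by auto
  obtain t0 where t0: "x < t0" "t0 < x + h" "D 0 (x + h) = (\<Sum>m<5. (D (m + 0) x / fact m) * h ^ m) + D (5 + 0) t0 / fact 5 * h ^ 5"
    using T[of 5 0] by auto
  obtain t1 where t1: "x < t1" "t1 < x + h" "D 1 (x + h) = (\<Sum>m<4. (D (m + 1) x / fact m) * h ^ m) + D (4 + 1) t1 / fact 4 * h ^ 4"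
    using T[of 4 1] by auto
  obtain t2 where t2: "x < t2" "t2 < x + h" "D 2 (x + h) = (\<Sum>m<3. (D (m + 2) x / fact m) * h ^ m) + D (3 + 2) t2 / fact 3 * h ^ 3"
    using T[of 3 2] by auto
  have e0: "D 0 (x + h) = D 0 x + D 1 x * h + D 2 x / 2 * h ^ 2 + D 3 x / 6 * h ^ 3 + D 4 x / 24 * h ^ 4 + D 5 t0 / 120 * h ^ 5"
    unfolding t0(3) by (simp add: eval_nat_numeral)
  have e1: "D 1 (x + h) = D 1 x + D 2 x * h + D 3 x / 2 * h ^ 2 + D 4 x / 6 * h ^ 3 + D 5 t1 / 24 * h ^ 4"
    unfolding t1(3) by (simp add: eval_nat_numeral)
  have e2: "D 2 (x + h) = D 2 x + D 3 x * h + D 4 x / 2 * h ^ 2 + D 5 t2 / 6 * h ^ 3"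
    unfolding t2(3) by (simp add: eval_nat_numeral)
  have "h * (D 1 x + D 1 (x + h)) / 2 - (D 0 (x + h) - D 0 x) - h\<^sup>2 / 12 * (D 2 (x + h) - D 2 x)
     = (D 5 t1 / 48 - D 5 t0 / 120 - D 5 t2 / 72) * h ^ 5"
    unfolding e0 e1 e2 by (simp add: field_simps eval_nat_numeral)
  moreover have "\<bar>D 5 t1 / 48 - D 5 t0 / 120 - D 5 t2 / 72\<bar> \<le> M"
    using M[of t0] M[of t1] M[of t2] t0(1,2) t1(1,2) t2(1,2) unfolding abs_le_iff by linarith
  ultimately show ?thesis
    using h by (simp only: abs_mult) (simp add: mult_right_mono)
qed

text \<open>The corrections of neighbouring steps telescope, and \<open>n\<close> errors of size
  \<open>M / n^5\<close> add up to \<open>M / n^4\<close>.\<close>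

lemma euler_maclaurin_trapezoid:
  fixes D :: "nat \<Rightarrow> real \<Rightarrow> real"
  assumes D: "\<And>m t. m < 5 \<Longrightarrow> 0 \<le> t \<Longrightarrow> t \<le> 1 \<Longrightarrow> (D m has_field_derivative D (Suc m) t) (at t)"
    and M: "\<And>t. 0 \<le> t \<Longrightarrow> t \<le> 1 \<Longrightarrow> \<bar>D 5 t\<bar> \<le> M" and n: "n > 0"
  shows "\<bar>(\<Sum>k<n. (D 1 (real k / real n) + D 1 (real (Suc k) / real n)) / 2) / real n
     - (D 0 1 - D 0 0) - (D 2 1 - D 2 0) / (12 * (real n)\<^sup>2)\<bar> \<le> M / real n ^ 4"
proof -
  define h where "h = 1 / real n"
  have h: "h > 0" using n by (simp add: h_def)
  define x where "x k = real k / real n" for k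
  have xs: "x (Suc k) = x k + h" for k by (simp add: x_def h_def add_divide_distrib)
  have x0: "x 0 = 0" "x n = 1" using n by (simp_all add: x_def)
  have x1: "0 \<le> x k" "x k + h \<le> 1" if "k < n" for k
    using that unfolding xs[symmetric] by (auto simp: x_def)
  define E where "E k = h * (D 1 (x k) + D 1 (x (Suc k))) / 2 - (D 0 (x (Suc k)) - D 0 (x k)) - h\<^sup>2 / 12 * (D 2 (x (Suc k)) - D 2 (x k))" for k
  have E: "\<bar>E k\<bar> \<le> M * h ^ 5" if "k < n" for k
    unfolding E_def xs using x1[OF that] by (intro trapezoid_step D M h) linarith+
  have "(\<Sum>k<n. E k) = (\<Sum>k<n. (D 1 (x k) + D 1 (x (Suc k))) / 2) / real n
     - (D 0 1 - D 0 0) - (D 2 1 - D 2 0) / (12 * (real n)\<^sup>2)"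
  proof -
    have "(\<Sum>k<n. E k) = (\<Sum>k<n. h * ((D 1 (x k) + D 1 (x (Suc k))) / 2)) - (\<Sum>k<n. D 0 (x (Suc k)) - D 0 (x k))
      - (\<Sum>k<n. h\<^sup>2 / 12 * (D 2 (x (Suc k)) - D 2 (x k)))"
      unfolding E_def sum_subtractf by simp
    also have "\<dots> = h * (\<Sum>k<n. (D 1 (x k) + D 1 (x (Suc k))) / 2) - (D 0 1 - D 0 0) - h\<^sup>2 / 12 * (D 2 1 - D 2 0)"
      unfolding sum_distrib_left[symmetric] sum_lessThan_telescope[of "\<lambda>k. D i (x k)" for i] x0 ..
    finally show ?thesis by (simp add: h_def power_divide)
  qed
  moreover have "\<bar>\<Sum>k<n. E k\<bar> \<le> (\<Sum>k<n. M * h ^ 5)"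
    by (rule order_trans[OF sum_abs sum_mono]) (use E in simp)
  moreover have "(\<Sum>k<n. M * h ^ 5) = M / real n ^ 4"
    using n by (simp add: h_def power_divide eval_nat_numeral)
  ultimately show ?thesis unfolding x_def by simp
qed

context pos_form
begin

text \<open>By homogeneity \<open>1 / Q k n\<close> is \<open>1 / n^2\<close> times
  \<open>1 / Q (k / n) 1\<close>, so the sum is \<open>1 / n\<close> times a trapezoidal rule on the
  unit interval. The first coefficient is the integral of \<open>1 / Q t 1\<close>, the second comes
  from its derivative at the two ends.\<close>

lemma side_sum_expansion:
  "\<exists>C. \<forall>n>0. \<bar>(\<Sum>k<n. (1 / Q (real k) (real n) + 1 / Q (real (Suc k)) (real n)) / 2)
     - 2 / rt * beta 1 / real n - (b / c\<^sup>2 - (2 * a + b) / (a + b + c)\<^sup>2) / 12 / real n ^ 3\<bar> \<le> C / real n ^ 5"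
proof -
  define u p where "u t = 1 / Q t 1" and "p t = 2 * a * t + b" for t
  \<comment> \<open>The list holds an antiderivative of \<open>u\<close>, then \<open>u\<close> and
    its first four derivatives. They are polynomials in \<open>p\<close> and \<open>u\<close>
    because \<open>p\<close> has derivative \<open>2 * a\<close> and \<open>u\<close> has derivative
    \<open>- p * u ^ 2\<close>.\<close>
  define D where "D m t = [2 / rt * beta t, u t, - p t * u t ^ 2, - 2 * a * u t ^ 2 + 2 * p t ^ 2 * u t ^ 3,
     12 * a * p t * u t ^ 3 - 6 * p t ^ 3 * u t ^ 4,
     24 * a ^ 2 * u t ^ 3 - 72 * a * p t ^ 2 * u t ^ 4 + 24 * p t ^ 4 * u t ^ 5] ! m" for m t
  have dp: "(p has_field_derivative 2 * a) (at t)" for t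
    unfolding p_def[abs_def] by (auto intro!: derivative_eq_intros)
  have du: "(u has_field_derivative - p t * u t ^ 2) (at t)" for t
  proof -
    have "((\<lambda>t. Q t 1) has_field_derivative p t) (at t)"
      unfolding Q_def p_def by (auto intro!: derivative_eq_intros)
    from DERIV_inverse'[OF this] Q_t1_pos[of t] show ?thesis
      unfolding u_def[abs_def] by (simp add: divide_inverse power2_eq_square mult_ac)
  qed
  have db: "((\<lambda>t. 2 / rt * beta t) has_field_derivative u t) (at t)" for t
    using DERIV_cmult[OF beta_deriv, of "2 / rt" t UNIV] rt_pos by (simp add: u_def)
  have D: "(D m has_field_derivative D (Suc m) t) (at t)" if "m < 5" for m t
  proof -
    consider "m = 0" | "m = 1" | "m = 2" | "m = 3" | "m = 4" using \<open>m < 5\<close> by linarith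
    then show ?thesis
    proof cases
      case 1 then show ?thesis using db by (simp add: D_def[abs_def])
    next
      case 2 then show ?thesis using du by (simp add: D_def[abs_def])
    next
      case 3
      have "((\<lambda>t. - p t * u t ^ 2) has_field_derivative
          - (2 * a) * u t ^ 2 + 2 * u t * (- p t * u t ^ 2) * - p t) (at t)"
        using DERIV_mult[OF DERIV_minus[OF dp[of t]] DERIV_power[OF du[of t], of 2]] by (simp add: mult_ac)
      also have "- (2 * a) * u t ^ 2 + 2 * u t * (- p t * u t ^ 2) * - p t = - 2 * a * u t ^ 2 + 2 * p t ^ 2 * u t ^ 3"
        by algebra
      finally show ?thesis by (simp add: 3 D_def[abs_def])
    next
      case 4
      have "((\<lambda>t. - 2 * a * u t ^ 2 + 2 * p t ^ 2 * u t ^ 3) has_field_derivative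
          - 2 * a * (2 * u t * (- p t * u t ^ 2)) + (2 * (2 * p t * (2 * a)) * u t ^ 3 + 3 * u t ^ 2 * (- p t * u t ^ 2) * (2 * p t ^ 2))) (at t)"
        using DERIV_add[OF DERIV_cmult[OF DERIV_power[OF du[of t], of 2], of "- 2 * a"]
          DERIV_mult[OF DERIV_cmult[OF DERIV_power[OF dp[of t], of 2], of 2] DERIV_power[OF du[of t], of 3]]]
        by (simp add: mult_ac)
      also have "- 2 * a * (2 * u t * (- p t * u t ^ 2)) + (2 * (2 * p t * (2 * a)) * u t ^ 3 + 3 * u t ^ 2 * (- p t * u t ^ 2) * (2 * p t ^ 2))
        = 12 * a * p t * u t ^ 3 - 6 * p t ^ 3 * u t ^ 4"
        by algebra
      finally show ?thesis by (simp add: 4 D_def[abs_def] numeral_3_eq_3)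
    next
      case 5
      have "((\<lambda>t. 12 * a * p t * u t ^ 3 - 6 * p t ^ 3 * u t ^ 4) has_field_derivative
          (12 * a * (2 * a) * u t ^ 3 + 3 * u t ^ 2 * (- p t * u t ^ 2) * (12 * a * p t))
           - (6 * (3 * p t ^ 2 * (2 * a)) * u t ^ 4 + 4 * u t ^ 3 * (- p t * u t ^ 2) * (6 * p t ^ 3))) (at t)"
        using DERIV_diff[OF DERIV_mult[OF DERIV_cmult[OF dp[of t], of "12 * a"] DERIV_power[OF du[of t], of 3]]
          DERIV_mult[OF DERIV_cmult[OF DERIV_power[OF dp[of t], of 3], of 6] DERIV_power[OF du[of t], of 4]]]
        by (simp add: mult_ac)
      also have "(12 * a * (2 * a) * u t ^ 3 + 3 * u t ^ 2 * (- p t * u t ^ 2) * (12 * a * p t))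
           - (6 * (3 * p t ^ 2 * (2 * a)) * u t ^ 4 + 4 * u t ^ 3 * (- p t * u t ^ 2) * (6 * p t ^ 3))
        = 24 * a ^ 2 * u t ^ 3 - 72 * a * p t ^ 2 * u t ^ 4 + 24 * p t ^ 4 * u t ^ 5"
        by algebra
      finally show ?thesis by (simp add: 5 D_def[abs_def])
    qed
  qed
  have cont: "continuous_on {0..1} u" "continuous_on {0..1} p"
    by (rule DERIV_continuous_on, rule has_field_derivative_at_within, rule du dp)+
  have "continuous_on {0..1} (\<lambda>t. D 5 t)"
    unfolding D_def by (simp add: eval_nat_numeral) (intro continuous_intros cont)
  then have "bounded ((\<lambda>t. D 5 t) ` {0..1})"
    by (intro compact_imp_bounded compact_continuous_image) auto
  then obtain M where "\<forall>t\<in>{0..1}. \<bar>D 5 t\<bar> \<le> M"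
    unfolding bounded_iff by auto
  then have M: "\<bar>D 5 t\<bar> \<le> M" if "0 \<le> t" "t \<le> 1" for t
    using that by simp
  show ?thesis
  proof (intro exI[of _ M] allI impI)
    fix n :: nat assume n: "n > 0"
    have nn: "real n > 0" using n by simp
    have D1: "D 1 (real k / real n) = (real n)\<^sup>2 * (1 / Q (real k) (real n))" for k
    proof -
      have "Q (real k) (real n) = (real n)\<^sup>2 * Q (real k / real n) 1"
        using Q_scale[of "real n" "real k / real n" 1] nn by simp
      then show ?thesis using nn by (simp add: D_def u_def)
    qed
    have D0: "D 0 1 - D 0 0 = 2 / rt * beta 1" by (simp add: D_def)
    have D2: "D 2 1 - D 2 0 = b / c\<^sup>2 - (2 * a + b) / (a + b + c)\<^sup>2"
      by (simp add: D_def p_def u_def Q_def power_divide add_divide_distrib diff_divide_distrib)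
    define S where "S = (\<Sum>k<n. (1 / Q (real k) (real n) + 1 / Q (real (Suc k)) (real n)) / 2)"
    have S: "(\<Sum>k<n. (D 1 (real k / real n) + D 1 (real (Suc k) / real n)) / 2) / real n = real n * S"
      unfolding D1 S_def sum_distrib_left sum_divide_distrib
      using nn by (intro sum.cong refl) (simp add: field_simps power2_eq_square)
    define A B where "A = 2 / rt * beta 1" and "B = b / c\<^sup>2 - (2 * a + b) / (a + b + c)\<^sup>2"
    have "\<bar>real n * S - A - B / (12 * (real n)\<^sup>2)\<bar> \<le> M / real n ^ 4"
      using euler_maclaurin_trapezoid[OF D M n] unfolding S D0 D2 A_def B_def by simp
    moreover have "real n * S - A - B / (12 * (real n)\<^sup>2) = real n * (S - A / real n - B / 12 / real n ^ 3)"
      using nn by (simp add: field_simps eval_nat_numeral)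
    ultimately have "real n * \<bar>S - A / real n - B / 12 / real n ^ 3\<bar> \<le> M / real n ^ 4"
      by (simp add: abs_mult)
    then have "\<bar>S - A / real n - B / 12 / real n ^ 3\<bar> \<le> M / real n ^ 4 / real n"
      by (simp only: pos_le_divide_eq[OF nn] mult.commute)
    also have "\<dots> = M / real n ^ 5" by (simp add: eval_nat_numeral)
    finally show "\<bar>S - 2 / rt * beta 1 / real n - (b / c\<^sup>2 - (2 * a + b) / (a + b + c)\<^sup>2) / 12 / real n ^ 3\<bar> \<le> M / real n ^ 5"
      by (simp only: A_def B_def)
  qed
qed

end


section \<open>Tails of the columns\<close>

text \<open>Each term is dominated by an increment of \<open>2 / x^2\<close>, and the increments
  telescope. With the constant 2 the comparison reduces to \<open>3 * x^2 >= 1\<close>.\<close>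

lemma sum_inverse_cube_le:
  assumes "J \<ge> 1"
  shows "(\<Sum>i<p. 1 / (real J + real i) ^ 3) \<le> 2 / (real J)\<^sup>2 - 2 / (real J + real p)\<^sup>2"
proof (induction p)
  case (Suc p)
  define x where "x = real J + real p"
  have x: "x \<ge> 1" using assms by (simp add: x_def)
  have "1 / x ^ 3 \<le> 2 / x\<^sup>2 - 2 / (x + 1)\<^sup>2"
  proof -
    have "2 / x\<^sup>2 - 2 / y\<^sup>2 - 1 / x ^ 3 = (2 * x * y\<^sup>2 - 2 * x ^ 3 - y\<^sup>2) / (x ^ 3 * y\<^sup>2)" if "y > 0" for y
      using x that by (simp add: field_simps eval_nat_numeral)
    moreover have "2 * x * (x + 1)\<^sup>2 - 2 * x ^ 3 - (x + 1)\<^sup>2 = 3 * x\<^sup>2 - 1"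
      by algebra
    ultimately have "2 / x\<^sup>2 - 2 / (x + 1)\<^sup>2 - 1 / x ^ 3 = (3 * x\<^sup>2 - 1) / (x ^ 3 * (x + 1)\<^sup>2)"
      using x by simp
    moreover have "3 * x\<^sup>2 - 1 \<ge> 0" using x one_le_power[of x 2] by linarith
    then have "0 \<le> (3 * x\<^sup>2 - 1) / (x ^ 3 * (x + 1)\<^sup>2)"
      using x by (intro divide_nonneg_nonneg) simp_all
    ultimately show ?thesis by linarith
  qed
  then show ?case using Suc unfolding x_def by (simp add: add_ac)
qed simp

context pos_form
begin

definition column_tail :: "nat \<Rightarrow> nat \<Rightarrow> real" where
  "column_tail j J = (\<Sum>i. 1 / Q (real j) (real (J + Suc i)))"

lemma Q_lower: "rt\<^sup>2 / (4 * a) * y\<^sup>2 \<le> Q x y"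
proof -
  have "rt\<^sup>2 * y\<^sup>2 \<le> 4 * a * Q x y" unfolding four_a_Q by simp
  then show ?thesis using a_pos by (simp add: field_simps)
qed

lemma summable_row: "summable (\<lambda>i. 1 / Q (real j) (real (J + Suc i)))"
proof (rule summable_comparison_test')
  have "summable (\<lambda>i. 1 / (real (i + 1))\<^sup>2)" by (rule summable_inverse_Suc_square)
  then show "summable (\<lambda>i. 4 * a / rt\<^sup>2 * (1 / (real (i + 1))\<^sup>2))" by (rule summable_mult)
  fix i
  have q: "0 < rt\<^sup>2 / (4 * a) * (real (i + 1))\<^sup>2" using rt_pos a_pos by simp
  have "rt\<^sup>2 / (4 * a) * (real (i + 1))\<^sup>2 \<le> rt\<^sup>2 / (4 * a) * (real (J + Suc i))\<^sup>2"
    using rt_pos a_pos by (intro mult_left_mono power_mono) auto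
  also have "\<dots> \<le> Q (real j) (real (J + Suc i))" by (rule Q_lower)
  finally have le: "rt\<^sup>2 / (4 * a) * (real (i + 1))\<^sup>2 \<le> Q (real j) (real (J + Suc i))" .
  have "1 / Q (real j) (real (J + Suc i)) \<le> 1 / (rt\<^sup>2 / (4 * a) * (real (i + 1))\<^sup>2)"
    using frac_le[OF _ _ q le, of 1 1] by simp
  moreover have "0 < Q (real j) (real (J + Suc i))" using le q by linarith
  ultimately show "norm (1 / Q (real j) (real (J + Suc i))) \<le> 4 * a / rt\<^sup>2 * (1 / (real (i + 1))\<^sup>2)"
    by simp
qed

text \<open>Homogeneity reduces the integral in \<open>y\<close> to the integral that defines
  \<open>beta\<close>, in the variable \<open>x / y\<close>. Since \<open>beta 0 = 0\<close>, this
  antiderivative vanishes at infinity, so the integral over \<open>[y, infinity)\<close> is a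
  multiple of \<open>beta (x / y)\<close>.\<close>

lemma row_antideriv:
  assumes "x > 0" "y > 0"
  shows "((\<lambda>y. - 2 / (rt * x) * beta (x / y)) has_field_derivative 1 / Q x y) (at y)"
proof -
  have "((\<lambda>y. x / y) has_field_derivative - x / y\<^sup>2) (at y)"
    using assms by (auto intro!: derivative_eq_intros simp: power2_eq_square)
  from DERIV_cmult[OF DERIV_chain2[OF beta_deriv this], of "- 2 / (rt * x)"]
  have "((\<lambda>y. - 2 / (rt * x) * beta (x / y)) has_field_derivative
     - 2 / (rt * x) * (rt / (2 * Q (x / y) 1) * (- x / y\<^sup>2))) (at y)" .
  moreover have "Q x y = y\<^sup>2 * Q (x / y) 1" using Q_scale[of y "x / y" 1] assms by simp
  ultimately show ?thesis using rt_pos assms(1) by (simp add: mult.commute)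
qed

lemma recip_Q_deriv:
  assumes "y > 0"
  shows "((\<lambda>y. 1 / Q x y) has_field_derivative - (b * x + 2 * c * y) / (Q x y)\<^sup>2) (at y)"
proof -
  have "((\<lambda>y. Q x y) has_field_derivative (b * x + 2 * c * y)) (at y)"
    unfolding Q_def by (auto intro!: derivative_eq_intros)
  moreover have "Q x y \<noteq> 0" using Q_pos[of x y] assms by simp
  ultimately have "((\<lambda>y. inverse (Q x y)) has_field_derivative
      - (inverse (Q x y) * (b * x + 2 * c * y) * inverse (Q x y))) (at y)"
    by (rule DERIV_inverse')
  moreover have "- (inverse (Q x y) * (b * x + 2 * c * y) * inverse (Q x y)) = - (b * x + 2 * c * y) / (Q x y)\<^sup>2"
    by (simp only: divide_inverse power2_eq_square inverse_mult_distrib mult_minus_left) (simp only: mult_ac)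
  ultimately show ?thesis by (simp only: divide_inverse mult_1)
qed

definition tail_const where "tail_const = (\<bar>b\<bar> + 2 * c) / (rt\<^sup>2 / (4 * a))\<^sup>2"

lemma K_nonneg: "tail_const \<ge> 0"
  using c_pos by (simp add: tail_const_def)

lemma recip_Q_deriv_bound:
  assumes "0 < x" "x \<le> y"
  shows "\<bar>- (b * x + 2 * c * y) / (Q x y)\<^sup>2\<bar> \<le> tail_const / y ^ 3"
proof -
  have y: "y > 0" using assms by simp
  have q: "0 < (rt\<^sup>2 / (4 * a) * y\<^sup>2)\<^sup>2" using rt_pos a_pos y by simp
  have "(rt\<^sup>2 / (4 * a) * y\<^sup>2)\<^sup>2 \<le> (Q x y)\<^sup>2"
    using Q_lower[of y x] a_pos by (intro power_mono) auto
  moreover have "\<bar>b * x + 2 * c * y\<bar> \<le> (\<bar>b\<bar> + 2 * c) * y"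
  proof -
    have "\<bar>b * x + 2 * c * y\<bar> \<le> \<bar>b\<bar> * x + 2 * c * y"
      using abs_triangle_ineq[of "b * x" "2 * c * y"] assms c_pos by (simp add: abs_mult)
    also have "\<dots> \<le> \<bar>b\<bar> * y + 2 * c * y" using assms by (simp add: mult_left_mono)
    finally show ?thesis by (simp add: distrib_right)
  qed
  ultimately have "\<bar>b * x + 2 * c * y\<bar> / (Q x y)\<^sup>2 \<le> (\<bar>b\<bar> + 2 * c) * y / (rt\<^sup>2 / (4 * a) * y\<^sup>2)\<^sup>2"
    using q c_pos y by (intro frac_le) auto
  also have "\<dots> = tail_const * (y / (y\<^sup>2)\<^sup>2)" unfolding tail_const_def power_mult_distrib by simp
  also have "y / (y\<^sup>2)\<^sup>2 = 1 / y ^ 3" using y by (simp add: field_simps eval_nat_numeral)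
  finally show ?thesis unfolding abs_divide abs_minus_cancel by simp
qed

text \<open>The integral of \<open>1 / Q x\<close> over \<open>[y, y + 1]\<close> is a value
  \<open>1 / Q x z\<close> by the mean value theorem; a second use of it bounds the distance to the
  right endpoint by the derivative in \<open>y\<close>.\<close>

lemma tail_step:
  assumes "0 < x" "x \<le> y"
  shows "\<bar>1 / Q x (y + 1) - (- 2 / (rt * x) * beta (x / (y + 1)) - (- 2 / (rt * x) * beta (x / y)))\<bar> \<le> tail_const / y ^ 3"
proof -
  have y: "y > 0" using assms by simp
  define G where "G y = - 2 / (rt * x) * beta (x / y)" for y
  obtain z where z: "y < z" "z < y + 1" "G (y + 1) - G y = (y + 1 - y) * (1 / Q x z)"
    using MVT2[of y "y + 1" G "\<lambda>y. 1 / Q x y"] row_antideriv[of x] y assms(1)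
    unfolding G_def by fastforce
  obtain w where w: "z < w" "w < y + 1" "1 / Q x (y + 1) - 1 / Q x z = (y + 1 - z) * (- (b * x + 2 * c * w) / (Q x w)\<^sup>2)"
    using MVT2[of z "y + 1" "\<lambda>y. 1 / Q x y" "\<lambda>w. - (b * x + 2 * c * w) / (Q x w)\<^sup>2"] recip_Q_deriv[of _ x] y z
    by fastforce
  have "\<bar>1 / Q x (y + 1) - 1 / Q x z\<bar> = (y + 1 - z) * \<bar>- (b * x + 2 * c * w) / (Q x w)\<^sup>2\<bar>"
    unfolding w(3) abs_mult using z by simp
  also have "\<dots> \<le> 1 * (tail_const / w ^ 3)"
    using z w y assms by (intro mult_mono recip_Q_deriv_bound) auto
  also have "\<dots> \<le> tail_const / y ^ 3"
    using K_nonneg y w z by (simp add: frac_le power_mono)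
  finally show ?thesis using z(3) by (simp add: G_def)
qed

text \<open>Summing \<open>tail_step\<close> over the column compares the tail with its integral.
  The error of order \<open>1 / J^2\<close> is small enough to be added over \<open>J\<close>
  columns.\<close>

lemma tail_approx:
  assumes "1 \<le> j" "j \<le> J"
  shows "\<bar>column_tail j J - 2 / rt * (beta_quot (real j / real J) / real J)\<bar> \<le> 2 * tail_const / (real J)\<^sup>2"
proof -
  define G where "G y = - 2 / (rt * real j) * beta (real j / y)" for y
  define S where "S p = (\<Sum>i<p. 1 / Q (real j) (real (J + Suc i)))" for p
  have j: "real j > 0" "real J > 0" using assms by auto
  have bnd: "\<bar>S p - (G (real (J + p)) - G (real J))\<bar> \<le> 2 * tail_const / (real J)\<^sup>2" for p
  proof -
    have "G (real (J + p)) - G (real J) = (\<Sum>i<p. G (real (J + Suc i)) - G (real (J + i)))"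
      using sum_lessThan_telescope[of "\<lambda>i. G (real (J + i))" p] by simp
    then have "S p - (G (real (J + p)) - G (real J)) = (\<Sum>i<p. 1 / Q (real j) (real (J + Suc i)) -
        (G (real (J + Suc i)) - G (real (J + i))))"
      unfolding S_def by (simp only: sum_subtractf)
    also have "\<bar>\<dots>\<bar> \<le> (\<Sum>i<p. tail_const / (real J + real i) ^ 3)"
    proof (rule order_trans[OF sum_abs sum_mono])
      fix i
      show "\<bar>1 / Q (real j) (real (J + Suc i)) - (G (real (J + Suc i)) - G (real (J + i)))\<bar> \<le> tail_const / (real J + real i) ^ 3"
        using tail_step[of "real j" "real J + real i"] assms unfolding G_def by (simp add: add.assoc add.commute[of _ 1])
    qed
    also have "\<dots> = tail_const * (\<Sum>i<p. 1 / (real J + real i) ^ 3)" by (simp add: sum_distrib_left)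
    also have "\<dots> \<le> tail_const * (2 / (real J)\<^sup>2)"
    proof (rule mult_left_mono[OF _ K_nonneg])
      have "0 \<le> 2 / (real J + real p)\<^sup>2" by simp
      then show "(\<Sum>i<p. 1 / (real J + real i) ^ 3) \<le> 2 / (real J)\<^sup>2"
        using sum_inverse_cube_le[of J p] assms by linarith
    qed
    finally show ?thesis by (simp add: mult.commute)
  qed
  have "(\<lambda>p. real j / real (J + p)) \<longlonglongrightarrow> 0" by real_asymp
  from isCont_tendsto_compose[OF DERIV_isCont[OF beta_deriv] this]
  have "(\<lambda>p. beta (real j / real (J + p))) \<longlonglongrightarrow> 0" by simp
  then have "(\<lambda>p. G (real (J + p))) \<longlonglongrightarrow> - 2 / (rt * real j) * 0"
    unfolding G_def by (rule tendsto_mult_left)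
  moreover have "S \<longlonglongrightarrow> column_tail j J"
    unfolding S_def column_tail_def using summable_LIMSEQ[OF summable_row] .
  ultimately have "(\<lambda>p. \<bar>S p - (G (real (J + p)) - G (real J))\<bar>) \<longlonglongrightarrow> \<bar>column_tail j J - (- 2 / (rt * real j) * 0 - G (real J))\<bar>"
    by (intro tendsto_intros)
  then have "\<bar>column_tail j J - (- 2 / (rt * real j) * 0 - G (real J))\<bar> \<le> 2 * tail_const / (real J)\<^sup>2"
    by (rule LIMSEQ_le_const2) (use bnd in blast)
  \<comment> \<open>Dividing \<open>beta (j / J)\<close> by \<open>j\<close> instead of
    \<open>J\<close> is what turns \<open>beta\<close> into \<open>beta_quot\<close>.\<close>
  moreover have "G (real J) = - (2 / rt * (beta_quot (real j / real J) / real J))"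
    unfolding G_def beta_eq_row using j rt_pos by simp
  ultimately show ?thesis by simp
qed

text \<open>The main terms of \<open>tail_approx\<close> form a right Riemann sum of
  \<open>beta_quot\<close> with \<open>J\<close> cells, and the \<open>J\<close> errors together are
  of order \<open>1 / J\<close>.\<close>

lemma tail_sum_tendsto: "(\<lambda>J. \<Sum>i<J. column_tail (Suc i) J) \<longlonglongrightarrow> 2 / rt * dilog 1"
proof -
  have "(\<lambda>J. (\<Sum>i<J. column_tail (Suc i) J) - 2 / rt * (\<Sum>i<J. beta_quot (real (Suc i) / real J) / real J)) \<longlonglongrightarrow> 0"
  proof (rule Lim_null_comparison)
    show "(\<lambda>J. 2 * tail_const / real J) \<longlonglongrightarrow> 0" by real_asymp
    show "\<forall>\<^sub>F J in sequentially. norm ((\<Sum>i<J. column_tail (Suc i) J) - 2 / rt * (\<Sum>i<J. beta_quot (real (Suc i) / real J) / real J)) \<le> 2 * tail_const / real J"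
    proof (rule eventually_sequentiallyI[of 1])
      fix J :: nat assume J: "1 \<le> J"
      have eq: "(\<Sum>i<J. column_tail (Suc i) J) - 2 / rt * (\<Sum>i<J. beta_quot (real (Suc i) / real J) / real J)
        = (\<Sum>i<J. column_tail (Suc i) J - 2 / rt * (beta_quot (real (Suc i) / real J) / real J))"
        by (simp only: sum_distrib_left sum_subtractf)
      have "\<bar>\<Sum>i<J. column_tail (Suc i) J - 2 / rt * (beta_quot (real (Suc i) / real J) / real J)\<bar>
        \<le> (\<Sum>i<J. 2 * tail_const / (real J)\<^sup>2)"
      proof (rule order_trans[OF sum_abs sum_mono])
        fix i assume "i \<in> {..<J}"
        then show "\<bar>column_tail (Suc i) J - 2 / rt * (beta_quot (real (Suc i) / real J) / real J)\<bar> \<le> 2 * tail_const / (real J)\<^sup>2"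
          by (intro tail_approx) auto
      qed
      also have "\<dots> = real J * (2 * tail_const / (real J)\<^sup>2)" by (simp only: sum_constant card_lessThan)
      also have "\<dots> = 2 * tail_const / real J" using J by (simp add: power2_eq_square del: of_nat_power)
      finally show "norm ((\<Sum>i<J. column_tail (Suc i) J) - 2 / rt * (\<Sum>i<J. beta_quot (real (Suc i) / real J) / real J)) \<le> 2 * tail_const / real J"
        by (simp only: real_norm_def eq)
    qed
  qed
  from tendsto_add[OF this tendsto_mult_left[OF row_riemann_sum, of "2 / rt"]] show ?thesis
    by (simp only: diff_add_cancel add_0)
qed

end


section \<open>Sums over boxes\<close>

lemma sum_symmetric_interval:
  fixes f :: "int \<Rightarrow> real"
  shows "(\<Sum>k\<in>{- int J..int J}. f k) = f 0 + (\<Sum>n<J. f (int (Suc n)) + f (- int (Suc n)))"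
proof (induction J)
  case (Suc J)
  have "{- int (Suc J)..int (Suc J)} = insert (int (Suc J)) (insert (- int (Suc J)) {- int J..int J})"
    by auto
  then show ?case using Suc by simp
qed simp

lemma trapezoid_sum_Suc:
  fixes f :: "nat \<Rightarrow> real"
  shows "(\<Sum>k<Suc J. (f k + f (Suc k)) / 2) = f 0 / 2 + (\<Sum>k<J. f (Suc k)) + f (Suc J) / 2"
  by (induction J) (simp_all add: field_simps)

context pos_form
begin

lemma neg_form: "pos_form a (- b) c"
  using a_pos c_pos disc by unfold_locales auto

lemma swap_form: "pos_form c b a"
  using a_pos c_pos disc by unfold_locales (auto simp: mult.commute mult.left_commute)

lemma Q_neg: "pos_form.Q a (- b) c x y = Q x (- y)"
  by (simp add: Q_def pos_form.Q_def[OF neg_form])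

lemma Q_swap: "pos_form.Q c b a x y = Q y x"
  by (simp add: Q_def pos_form.Q_def[OF swap_form])

lemma Q_uminus: "Q (- x) y = Q x (- y)" "Q (- x) (- y) = Q x y"
  by (simp_all add: Q_def)

lemma rt_neg: "pos_form.rt a (- b) c = rt"
  by (simp add: rt_def pos_form.rt_def[OF neg_form])

lemma rt_swap: "pos_form.rt c b a = rt"
  by (simp add: rt_def pos_form.rt_def[OF swap_form] mult_ac)

text \<open>The parts \<open>arctan (b / rt)\<close> are odd in \<open>b\<close> and cancel. The
  resulting angle is the coefficient of \<open>ln (c / a)\<close>, and it also gives the leading
  term of the ring sums.\<close>

lemma beta_1_add_neg: "beta 1 + pos_form.beta a (- b) c 1 = pi / 2 - arctan ((c - a) / rt)"
proof -
  define u v where "u = (2 * a + b) / rt" and "v = (2 * a - b) / rt"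
  have uv: "u + v = 4 * a / rt" by (simp add: u_def v_def flip: add_divide_distrib)
  have "1 - u * v = (rt\<^sup>2 - (2 * a + b) * (2 * a - b)) / rt\<^sup>2"
    using rt_pos by (simp add: u_def v_def field_simps power2_eq_square)
  also have "rt\<^sup>2 - (2 * a + b) * (2 * a - b) = 4 * a * (c - a)"
    unfolding rt_square by (simp add: algebra_simps power2_eq_square)
  finally have "(1 - u * v) / (u + v) = (c - a) / rt"
    using uv rt_pos a_pos by (simp add: power2_eq_square)
  moreover have "beta 1 + pos_form.beta a (- b) c 1 = arctan u + arctan v"
    by (simp add: beta_def pos_form.beta_def[OF neg_form] rt_neg u_def v_def arctan_minus)
  moreover have "u + v > 0" using uv rt_pos a_pos by simp
  ultimately show ?thesis using arctan_add_pos[of u v] by simp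
qed

text \<open>The origin may stay in the range of summation because its term is \<open>1 / 0 = 0\<close>.\<close>

definition box_sum :: "nat \<Rightarrow> real" where
  "box_sum J = (\<Sum>j\<in>{- int J..int J}. \<Sum>k\<in>{- int J..int J}. 1 / Q (of_int j) (of_int k))"

definition column_sum :: "nat \<Rightarrow> nat \<Rightarrow> real" where
  "column_sum j J = 1 / Q (real j) 0 +
     (\<Sum>n<J. 1 / Q (real j) (real (Suc n)) + 1 / Q (real j) (- real (Suc n)))"

lemma box_eq: "box_sum J = 2 / c * (\<Sum>n<J. 1 / (real (n + 1))\<^sup>2) + 2 * (\<Sum>i<J. column_sum (Suc i) J)"
proof -
  have pos: "(\<Sum>k\<in>{- int J..int J}. 1 / Q (of_int (int (Suc i))) (of_int k)) = column_sum (Suc i) J" for i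
    unfolding sum_symmetric_interval column_sum_def by simp
  have neg: "(\<Sum>k\<in>{- int J..int J}. 1 / Q (of_int (- int (Suc i))) (of_int k)) = column_sum (Suc i) J" for i
    unfolding sum_symmetric_interval column_sum_def of_int_minus Q_uminus of_int_0 minus_zero minus_minus of_int_of_nat_eq
    by (simp only: add.commute)
  have zero: "(\<Sum>k\<in>{- int J..int J}. 1 / Q (of_int 0) (of_int k)) = 2 / c * (\<Sum>n<J. 1 / (real (n + 1))\<^sup>2)"
    unfolding sum_symmetric_interval sum_distrib_left of_int_minus of_int_of_nat_eq
    by (simp add: Q_def del: of_nat_Suc)
  have "box_sum J = (\<Sum>k\<in>{- int J..int J}. 1 / Q (of_int 0) (of_int k)) +
     (\<Sum>i<J. (\<Sum>k\<in>{- int J..int J}. 1 / Q (of_int (int (Suc i))) (of_int k)) +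
             (\<Sum>k\<in>{- int J..int J}. 1 / Q (of_int (- int (Suc i))) (of_int k)))"
    unfolding box_sum_def by (rule sum_symmetric_interval)
  also have "\<dots> = 2 / c * (\<Sum>n<J. 1 / (real (n + 1))\<^sup>2) + (\<Sum>i<J. column_sum (Suc i) J + column_sum (Suc i) J)"
    unfolding pos neg zero ..
  finally show ?thesis by (simp only: sum.distrib mult_2)
qed

lemma column_Suc: "column_sum j (Suc J) = column_sum j J + (1 / Q (real j) (real (Suc J)) + 1 / Q (real j) (- real (Suc J)))"
  by (simp add: column_sum_def)

text \<open>The axes and corners cut the boundary into eight half-sides. The four with nonnegative
  first coordinate appear here, and central symmetry gives the factor 2. Every axis point and every
  corner is an end of two half-sides, hence the trapezoidal weight one half.\<close>

lemma ring_eq_sides: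
  fixes n :: nat
  defines "S f \<equiv> \<Sum>k<Suc n. (f (real k) + f (real (Suc k))) / (2 :: real)"
  shows "box_sum (Suc n) - box_sum n = 2 * (S (\<lambda>x. 1 / Q x (real (Suc n))) + S (\<lambda>x. 1 / Q x (- real (Suc n)))
     + S (\<lambda>x. 1 / Q (real (Suc n)) x) + S (\<lambda>x. 1 / Q (real (Suc n)) (- x)))"
proof -
  define m where "m = real (Suc n)"
  have S: "S f = f 0 / 2 + (\<Sum>k<n. f (real (Suc k))) + f m / 2" for f
    unfolding S_def m_def using trapezoid_sum_Suc[of "\<lambda>k. f (real k)" n] by (simp only: of_nat_0)
  have m: "1 / Q 0 m = 1 / c * (1 / m\<^sup>2)" "1 / Q 0 (- m) = 1 / c * (1 / m\<^sup>2)" by (simp_all add: Q_def)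
  have "box_sum (Suc n) - box_sum n = 2 / c * (1 / m\<^sup>2) + 2 * column_sum (Suc n) (Suc n)
     + 2 * (\<Sum>i<n. 1 / Q (real (Suc i)) m + 1 / Q (real (Suc i)) (- m))"
    unfolding box_eq column_Suc sum.lessThan_Suc sum.distrib m_def[symmetric]
    by (simp add: algebra_simps m_def)
  also have "column_sum (Suc n) (Suc n) = 1 / Q m 0 + (\<Sum>i<n. 1 / Q m (real (Suc i))) + (\<Sum>i<n. 1 / Q m (- real (Suc i)))
     + 1 / Q m m + 1 / Q m (- m)"
    unfolding column_sum_def sum.lessThan_Suc sum.distrib m_def[symmetric] by simp
  finally show ?thesis
    unfolding m_def[symmetric] S m sum.distrib minus_zero by (simp add: algebra_simps)
qed

text \<open>The four half-sides are instances of \<open>side_sum_expansion\<close> for the forms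
  obtained by \<open>b\<close> to \<open>- b\<close> and by exchanging \<open>a\<close> and
  \<open>c\<close>.\<close>

lemma ring_expansion:
  "\<exists>C. \<forall>n. \<bar>box_sum (Suc n) - box_sum n - 4 * pi / rt / real (Suc n)
      - (- (1 / (a + b + c) + 1 / (a - b + c)) / 3) / real (Suc n) ^ 3\<bar> \<le> C / real (Suc n) ^ 5"
proof -
  interpret n: pos_form a "- b" c by (rule neg_form)
  interpret s: pos_form c b a by (rule swap_form)
  interpret sn: pos_form c "- b" a by (rule s.neg_form)
  have rts: "n.rt = rt" "s.rt = rt" "sn.rt = rt" using rt_neg rt_swap s.rt_neg by simp_all
  have Qs: "n.Q x y = Q x (- y)" "s.Q x y = Q y x" "sn.Q x y = Q y (- x)" for x y
    using Q_neg Q_swap s.Q_neg by (simp_all add: Q_uminus(1)[symmetric] Q_def sn.Q_def)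
  obtain C1 where C1: "\<And>m. m > 0 \<Longrightarrow> \<bar>(\<Sum>k<m. (1 / Q (real k) (real m) + 1 / Q (real (Suc k)) (real m)) / 2)
     - 2 / rt * beta 1 / real m - (b / c\<^sup>2 - (2 * a + b) / (a + b + c)\<^sup>2) / 12 / real m ^ 3\<bar> \<le> C1 / real m ^ 5"
    using side_sum_expansion by blast
  obtain C2 where C2: "\<And>m. m > 0 \<Longrightarrow> \<bar>(\<Sum>k<m. (1 / Q (real k) (- real m) + 1 / Q (real (Suc k)) (- real m)) / 2)
     - 2 / rt * n.beta 1 / real m - (- b / c\<^sup>2 - (2 * a + - b) / (a + - b + c)\<^sup>2) / 12 / real m ^ 3\<bar> \<le> C2 / real m ^ 5"
    using n.side_sum_expansion unfolding Qs rts by blast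
  obtain C3 where C3: "\<And>m. m > 0 \<Longrightarrow> \<bar>(\<Sum>k<m. (1 / Q (real m) (real k) + 1 / Q (real m) (real (Suc k))) / 2)
     - 2 / rt * s.beta 1 / real m - (b / a\<^sup>2 - (2 * c + b) / (c + b + a)\<^sup>2) / 12 / real m ^ 3\<bar> \<le> C3 / real m ^ 5"
    using s.side_sum_expansion unfolding Qs rts by blast
  obtain C4 where C4: "\<And>m. m > 0 \<Longrightarrow> \<bar>(\<Sum>k<m. (1 / Q (real m) (- real k) + 1 / Q (real m) (- real (Suc k))) / 2)
     - 2 / rt * sn.beta 1 / real m - (- b / a\<^sup>2 - (2 * c + - b) / (c + - b + a)\<^sup>2) / 12 / real m ^ 3\<bar> \<le> C4 / real m ^ 5"
    using sn.side_sum_expansion unfolding Qs rts by blast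
  \<comment> \<open>The four half-sides are seen under angles that fill a half turn; this produces
    \<open>4 * pi / rt\<close> after doubling.\<close>
  have betas: "beta 1 + n.beta 1 + s.beta 1 + sn.beta 1 = pi"
  proof -
    have "arctan ((a - c) / rt) = - arctan ((c - a) / rt)"
      unfolding arctan_minus[symmetric] minus_divide_left by simp
    then show ?thesis using beta_1_add_neg s.beta_1_add_neg by (simp add: rts)
  qed
  have p: "a + b + c > 0" "a - b + c > 0"
    using Q_pos[of 1 1] Q_pos[of 1 "-1"] by (simp_all add: Q_def)
  define e1 e2 e3 e4 where "e1 = b / c\<^sup>2 - (2 * a + b) / (a + b + c)\<^sup>2"
    and "e2 = - b / c\<^sup>2 - (2 * a + - b) / (a + - b + c)\<^sup>2"
    and "e3 = b / a\<^sup>2 - (2 * c + b) / (c + b + a)\<^sup>2"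
    and "e4 = - b / a\<^sup>2 - (2 * c + - b) / (c + - b + a)\<^sup>2"
  \<comment> \<open>The derivatives at the axis points cancel in pairs; at each corner the two
    contributions combine to a multiple of the value of \<open>Q\<close> there.\<close>
  have es: "e1 + e2 + e3 + e4 = - 2 * (1 / (a + b + c) + 1 / (a - b + c))"
  proof -
    define x y where "x = a + b + c" and "y = a - b + c"
    have x1: "c + b + a = x" "a + - b + c = y" "c + - b + a = y" by (simp_all add: x_def y_def)
    have xy: "x > 0" "y > 0" using p by (simp_all add: x_def y_def)
    have "e1 + e2 + e3 + e4 = - ((2 * a + b) + (2 * c + b)) / x\<^sup>2 - ((2 * a - b) + (2 * c - b)) / y\<^sup>2"
      unfolding e1_def e2_def e3_def e4_def x1 x_def[symmetric]
      by (simp add: add_divide_distrib diff_divide_distrib)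
    also have "(2 * a + b) + (2 * c + b) = 2 * x" by (simp add: x_def)
    also have "(2 * a - b) + (2 * c - b) = 2 * y" by (simp add: y_def)
    also have "- (2 * x) / x\<^sup>2 - 2 * y / y\<^sup>2 = - 2 * (1 / x + 1 / y)"
      using xy by (simp add: power2_eq_square field_simps)
    finally show ?thesis by (simp only: x_def y_def)
  qed
  show ?thesis
  proof (intro exI[of _ "2 * (C1 + C2 + C3 + C4)"] allI)
    fix k :: nat
    define m where "m = real (Suc k)"
    have comb: "\<bar>2 * (S1 + S2 + S3 + S4) - 2 * ((A1 + A2 + A3 + A4) + (B1 + B2 + B3 + B4))\<bar> \<le> 2 * (D1 + D2 + D3 + D4)"
      if "\<bar>S1 - A1 - B1\<bar> \<le> D1" "\<bar>S2 - A2 - B2\<bar> \<le> D2" "\<bar>S3 - A3 - B3\<bar> \<le> D3" "\<bar>S4 - A4 - B4\<bar> \<le> D4"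
      for S1 S2 S3 S4 A1 A2 A3 A4 B1 B2 B3 B4 D1 D2 D3 D4 :: real
    proof -
      have "2 * (S1 + S2 + S3 + S4) - 2 * ((A1 + A2 + A3 + A4) + (B1 + B2 + B3 + B4))
        = 2 * ((S1 - A1 - B1) + (S2 - A2 - B2) + ((S3 - A3 - B3) + (S4 - A4 - B4)))" by simp
      moreover have "\<bar>(S1 - A1 - B1) + (S2 - A2 - B2) + ((S3 - A3 - B3) + (S4 - A4 - B4))\<bar> \<le> D1 + D2 + (D3 + D4)"
        by (intro order_trans[OF abs_triangle_ineq add_mono] that)
      ultimately show ?thesis by (simp only: abs_mult) simp
    qed
    have "2 / rt * beta 1 / m + 2 / rt * n.beta 1 / m + 2 / rt * s.beta 1 / m + 2 / rt * sn.beta 1 / m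
      = 2 / rt * (beta 1 + n.beta 1 + s.beta 1 + sn.beta 1) / m"
      by (simp only: add_divide_distrib distrib_left)
    then have A: "2 / rt * beta 1 / m + 2 / rt * n.beta 1 / m + 2 / rt * s.beta 1 / m + 2 / rt * sn.beta 1 / m
      = 2 * pi / rt / m" unfolding betas by simp
    have "e1 / 12 / m ^ 3 + e2 / 12 / m ^ 3 + e3 / 12 / m ^ 3 + e4 / 12 / m ^ 3 = (e1 + e2 + e3 + e4) / 12 / m ^ 3"
      by (simp only: add_divide_distrib)
    then have B: "e1 / 12 / m ^ 3 + e2 / 12 / m ^ 3 + e3 / 12 / m ^ 3 + e4 / 12 / m ^ 3
      = - 2 * (1 / (a + b + c) + 1 / (a - b + c)) / 12 / m ^ 3" unfolding es .
    have "\<bar>(box_sum (Suc k) - box_sum k) - 2 * (2 * pi / rt / m + - 2 * (1 / (a + b + c) + 1 / (a - b + c)) / 12 / m ^ 3)\<bar>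
       \<le> 2 * (C1 / m ^ 5 + C2 / m ^ 5 + C3 / m ^ 5 + C4 / m ^ 5)"
      unfolding ring_eq_sides A[symmetric] B[symmetric] unfolding e1_def e2_def e3_def e4_def m_def
      by (rule comb; rule C1 C2 C3 C4; simp)
    moreover have "2 * (C1 / m ^ 5 + C2 / m ^ 5 + C3 / m ^ 5 + C4 / m ^ 5) = 2 * (C1 + C2 + C3 + C4) / m ^ 5"
      by (simp add: add_divide_distrib)
    moreover have "(box_sum (Suc k) - box_sum k) - 2 * (2 * pi / rt / m + - 2 * X / 12 / m ^ 3)
       = box_sum (Suc k) - box_sum k - 4 * pi / rt / m - (- X / 3) / m ^ 3" for X
      by simp
    ultimately show "\<bar>box_sum (Suc k) - box_sum k - 4 * pi / rt / real (Suc k)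
      - (- (1 / (a + b + c) + 1 / (a - b + c)) / 3) / real (Suc k) ^ 3\<bar> \<le> 2 * (C1 + C2 + C3 + C4) / real (Suc k) ^ 5"
      unfolding m_def by (simp only:)
  qed
qed

section \<open>Complete columns and the constant term\<close>

definition mu :: complex where "mu = Complex (- b / (2 * c)) (rt / (2 * c))"

lemma Im_mu_pos: "Im mu > 0"
  using rt_pos c_pos by (simp add: mu_def)

lemma norm_square_mu: "(cmod (of_real x * mu + of_real y))\<^sup>2 = Q x (- y) / c"
proof -
  have "(cmod (of_real x * mu + of_real y))\<^sup>2 = (y - x * b / (2 * c))\<^sup>2 + (x * rt / (2 * c))\<^sup>2"
    unfolding cmod_power2 by (simp add: mu_def algebra_simps)
  also have "\<dots> = (y - x * b / (2 * c))\<^sup>2 + x\<^sup>2 * (4 * a * c - b\<^sup>2) / (2 * c)\<^sup>2"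
    unfolding power_divide power_mult_distrib rt_square ..
  also have "\<dots> = Q x (- y) / c"
    using c_pos by (simp add: Q_def field_simps power2_eq_square)
  finally show ?thesis .
qed

text \<open>With \<open>z = j * mu\<close> the column becomes a row of
  \<open>1 / (cmod (z + k))^2\<close>. Positive ordinates of \<open>Q\<close> correspond to
  \<open>z - k\<close>, and negative ones, carried by the form with \<open>- b\<close>, to
  \<open>z + k\<close>.\<close>

lemma column_limit:
  fixes j :: nat
  assumes "j \<ge> 1"
  defines "w \<equiv> exp (2 * of_real pi * \<i> * mu) ^ j"
  shows "1 / Q (real j) 0 + column_tail j 0 + pos_form.column_tail a (- b) c j 0
     = 2 * pi / (rt * real j) * Re ((1 + w) / (1 - w))"
proof -
  interpret n: pos_form a "- b" c by (rule neg_form)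
  define z where "z = of_real (real j) * mu"
  have Imz: "Im z = real j * rt / (2 * c)" by (simp add: z_def mu_def)
  have zp: "Im z > 0" unfolding Imz using assms(1) rt_pos c_pos by simp
  have w: "exp (2 * of_real pi * \<i> * z) = w"
    unfolding w_def exp_of_nat_mult[symmetric] z_def by (simp add: mult_ac)
  have t1: "1 / (cmod (z + of_nat k))\<^sup>2 = c * (1 / n.Q (real j) (real k))" for k
    using norm_square_mu[of "real j" "real k"] by (simp add: z_def Q_neg)
  have t2: "1 / (cmod (z - of_nat (Suc k)))\<^sup>2 = c * (1 / Q (real j) (real (Suc k)))" for k
  proof -
    have "z - of_nat (Suc k) = of_real (real j) * mu + of_real (- real (Suc k))" by (simp add: z_def)
    then show ?thesis by (simp only: norm_square_mu minus_minus) simp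
  qed
  have s1: "(\<lambda>k. 1 / n.Q (real j) (real k)) sums (1 / Q (real j) 0 + n.column_tail j 0)"
  proof -
    have "(\<lambda>i. 1 / n.Q (real j) (real (Suc i))) sums n.column_tail j 0"
      using summable_sums[OF n.summable_row[of j 0]] unfolding n.column_tail_def by simp
    then show ?thesis
      unfolding sums_Suc_iff[of "\<lambda>k. 1 / n.Q (real j) (real k)"] by (simp add: Q_neg add.commute)
  qed
  have s2: "(\<lambda>k. 1 / Q (real j) (real (Suc k))) sums column_tail j 0"
    using summable_sums[OF summable_row[of j 0]] unfolding column_tail_def by simp
  have "(\<lambda>m. \<Sum>k<m. c * (1 / n.Q (real j) (real k)) + c * (1 / Q (real j) (real (Suc k))))
     \<longlonglongrightarrow> c * (1 / Q (real j) 0 + n.column_tail j 0) + c * column_tail j 0"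
    using sums_add[OF sums_mult[OF s1, of c] sums_mult[OF s2, of c]] unfolding sums_def .
  moreover have "(\<lambda>m. \<Sum>k<m. c * (1 / n.Q (real j) (real k)) + c * (1 / Q (real j) (real (Suc k))))
     \<longlonglongrightarrow> pi / Im z * Re ((1 + w) / (1 - w))"
    using lattice_row_sum[OF zp] unfolding t1 t2 w .
  ultimately have "c * (1 / Q (real j) 0 + n.column_tail j 0) + c * column_tail j 0 = pi / Im z * Re ((1 + w) / (1 - w))"
    by (rule LIMSEQ_unique)
  also have "pi / Im z = c * (2 * pi / (rt * real j))" unfolding Imz using c_pos by (simp add: mult_ac)
  finally have "c * (1 / Q (real j) 0 + column_tail j 0 + n.column_tail j 0) = c * (2 * pi / (rt * real j) * Re ((1 + w) / (1 - w)))"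
    by (simp only: distrib_left mult.assoc add_ac)
  then show ?thesis using c_pos by (simp only: mult_cancel_left) simp
qed

lemma tail_split: "column_tail j 0 = column_tail j J + (\<Sum>k<J. 1 / Q (real j) (real (Suc k)))"
  using suminf_split_initial_segment[OF summable_row[of j 0], of J]
  unfolding column_tail_def by (simp add: add_ac)

text \<open>Splitting \<open>(1 + w) / (1 - w)\<close> as \<open>1 + 2 * w / (1 - w)\<close>
  separates the harmonic term, which carries the divergence, from a Lambert term that decays
  exponentially in \<open>j\<close>.\<close>

lemma column_eq:
  fixes j :: nat
  assumes "j \<ge> 1"
  defines "w \<equiv> exp (2 * of_real pi * \<i> * mu) ^ j"
  shows "column_sum j J = 2 * pi / rt * (1 / real j + 2 * (Re (w / (1 - w)) / real j))
     - column_tail j J - pos_form.column_tail a (- b) c j J"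
proof -
  interpret n: pos_form a "- b" c by (rule neg_form)
  have "cmod w < 1"
  proof -
    have "cmod (exp (2 * of_real pi * \<i> * mu)) < 1" using Im_mu_pos by (rule norm_exp_2pi_i)
    then have "cmod (exp (2 * of_real pi * \<i> * mu)) ^ j < 1 ^ j"
      using assms(1) by (intro power_strict_mono) auto
    then show ?thesis unfolding w_def norm_power by simp
  qed
  then have "1 - w \<noteq> 0" by fastforce
  then have "(1 + w) / (1 - w) = 1 + 2 * (w / (1 - w))" by (simp add: field_simps)
  moreover have "Re (1 + 2 * v) = 1 + 2 * Re v" for v by simp
  ultimately have Re: "Re ((1 + w) / (1 - w)) = 1 + 2 * Re (w / (1 - w))" by (simp only:)
  have "column_sum j J = 1 / Q (real j) 0 + (\<Sum>k<J. 1 / Q (real j) (real (Suc k))) + (\<Sum>k<J. 1 / n.Q (real j) (real (Suc k)))"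
    unfolding column_sum_def sum.distrib Q_neg by simp
  also have "\<dots> = (1 / Q (real j) 0 + column_tail j 0 + n.column_tail j 0) - column_tail j J - n.column_tail j J"
    using tail_split[of j J] n.tail_split[of j J] by simp
  also have "1 / Q (real j) 0 + column_tail j 0 + n.column_tail j 0 = 2 * pi / (rt * real j) * (1 + 2 * Re (w / (1 - w)))"
    using column_limit[OF assms(1)] unfolding w_def[symmetric] Re .
  also have "\<dots> = 2 * pi / rt * (1 / real j + 2 * (Re (w / (1 - w)) / real j))"
    by (simp add: add_divide_distrib distrib_left)
  finally show ?thesis .
qed

text \<open>The Clausen value at \<open>pi + 2 * arctan (b / rt)\<close> changes sign with
  \<open>b\<close> and drops out; the other four are those of \<open>clausen_C\<close>.\<close>

lemma dilog_1_add_neg: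
  "dilog 1 + pos_form.dilog a (- b) c 1
     = (clausen_C a b c - (pi / 2 - arctan ((c - a) / rt)) * ln (c / a)) / 2"
proof -
  interpret n: pos_form a "- b" c by (rule neg_form)
  have "sqrt \<bar>b\<^sup>2 - 4 * a * c\<bar> = rt" using disc by (simp add: rt_def)
  then have C: "clausen_C a b c = Cl2 (pi - 2 * arctan ((2 * a - b) / rt)) + Cl2 (pi - 2 * arctan ((2 * a + b) / rt)) +
     Cl2 (pi - 2 * arctan ((2 * c - b) / rt)) + Cl2 (pi - 2 * arctan ((2 * c + b) / rt))"
    by (simp only: clausen_C_def Let_def)
  have "Cl2 (pi + 2 * arctan (- b / rt)) = - Cl2 (pi + 2 * arctan (b / rt))"
    using Cl2_reflect[of "pi + 2 * arctan (b / rt)"] by (simp add: arctan_minus algebra_simps)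
  then show ?thesis
    unfolding dilog_1 n.dilog_1 rt_neg C beta_1_add_neg[symmetric]
    by (simp add: field_simps)
qed

lemma box_harm_limit:
  "(\<lambda>J. box_sum J - 4 * pi / rt * harm J) \<longlonglongrightarrow>
     2 / rt * (- 4 * pi * ln (cmod (dedekind_eta mu))
        + (pi / 2 - arctan ((c - a) / rt)) * ln (c / a) - clausen_C a b c)"
proof -
  interpret n: pos_form a "- b" c by (rule neg_form)
  define q where "q = exp (2 * of_real pi * \<i> * mu)"
  define P where "P = (\<Prod>k. 1 - q ^ Suc k)"
  have q: "cmod q < 1" unfolding q_def using Im_mu_pos by (rule norm_exp_2pi_i)
  define L where "L i = Re (q ^ Suc i / (1 - q ^ Suc i)) / real (Suc i)" for i
  have eq: "box_sum J - 4 * pi / rt * harm J = 2 / c * (\<Sum>n<J. 1 / (real (n + 1))\<^sup>2) + 8 * pi / rt * (\<Sum>i<J. L i)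
     - 2 * (\<Sum>i<J. column_tail (Suc i) J) - 2 * (\<Sum>i<J. n.column_tail (Suc i) J)" for J
  proof -
    have h: "harm J = (\<Sum>i<J. 1 / real (Suc i))"
      by (simp add: harm_def sum.atLeast1_atMost_eq inverse_eq_divide)
    have "column_sum (Suc i) J = 2 * pi / rt * (1 / real (Suc i) + 2 * L i) - column_tail (Suc i) J - n.column_tail (Suc i) J" for i
      using column_eq[of "Suc i" J] unfolding q_def[symmetric] L_def by simp
    then have "(\<Sum>i<J. column_sum (Suc i) J) = 2 * pi / rt * (harm J + 2 * (\<Sum>i<J. L i))
        - (\<Sum>i<J. column_tail (Suc i) J) - (\<Sum>i<J. n.column_tail (Suc i) J)"
      unfolding h by (simp only: sum_subtractf sum_distrib_left[symmetric] sum.distrib)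
    then show ?thesis unfolding box_eq by (simp only:) (simp add: algebra_simps add_divide_distrib)
  qed
  have "(\<lambda>J. 2 / c * (\<Sum>n<J. 1 / (real (n + 1))\<^sup>2) + 8 * pi / rt * (\<Sum>i<J. L i)
     - 2 * (\<Sum>i<J. column_tail (Suc i) J) - 2 * (\<Sum>i<J. n.column_tail (Suc i) J))
     \<longlonglongrightarrow> 2 / c * (pi\<^sup>2 / 6) + 8 * pi / rt * (- ln (cmod P)) - 2 * (2 / rt * dilog 1) - 2 * (2 / rt * n.dilog 1)"
  proof (intro tendsto_diff tendsto_add tendsto_mult_left tail_sum_tendsto)
    show "(\<lambda>J. \<Sum>n<J. 1 / (real (n + 1))\<^sup>2) \<longlonglongrightarrow> pi\<^sup>2 / 6"
      using inverse_squares_sums unfolding sums_def by (simp add: add.commute)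
    show "(\<lambda>J. \<Sum>i<J. L i) \<longlonglongrightarrow> - ln (cmod P)"
      unfolding L_def P_def using q by (rule lambert_log_product(1))
    show "(\<lambda>J. \<Sum>i<J. n.column_tail (Suc i) J) \<longlonglongrightarrow> 2 / rt * n.dilog 1"
      using n.tail_sum_tendsto by (simp only: rt_neg)
  qed
  also have "2 / c * (pi\<^sup>2 / 6) + 8 * pi / rt * (- ln (cmod P)) - 2 * (2 / rt * dilog 1) - 2 * (2 / rt * n.dilog 1)
    = 2 / c * (pi\<^sup>2 / 6) + 8 * pi / rt * (- ln (cmod P)) - 4 / rt * (dilog 1 + n.dilog 1)"
    by (simp add: algebra_simps)
  also have "ln (cmod P) = ln (cmod (dedekind_eta mu)) + pi * (rt / (2 * c)) / 12"
    using ln_norm_dedekind_eta[OF Im_mu_pos] unfolding q_def[symmetric] P_def[symmetric] by (simp add: mu_def)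
  \<comment> \<open>The column \<open>j = 0\<close> contributes \<open>pi^2 / (3 * c)\<close>, which
    cancels exactly against the exponential prefactor of the eta function.\<close>
  also have "2 / c * (pi\<^sup>2 / 6) + 8 * pi / rt * (- (ln (cmod (dedekind_eta mu)) + pi * (rt / (2 * c)) / 12)) - 4 / rt * (dilog 1 + n.dilog 1)
    = 2 / rt * (- 4 * pi * ln (cmod (dedekind_eta mu))) - 4 / rt * (dilog 1 + n.dilog 1)"
    using rt_pos c_pos by (simp add: field_simps power2_eq_square)
  also have "\<dots> = 2 / rt * (- 4 * pi * ln (cmod (dedekind_eta mu))
        + (pi / 2 - arctan ((c - a) / rt)) * ln (c / a) - clausen_C a b c)"
  proof -
    have "2 / rt * E - 4 / rt * ((C - X) / 2) = 2 / rt * (E + X - C)" for E C X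
      by (simp add: algebra_simps add_divide_distrib diff_divide_distrib)
    then show ?thesis unfolding dilog_1_add_neg .
  qed
  finally show ?thesis unfolding eq .
qed

end


section \<open>Asymptotic expansion\<close>

text \<open>The distance to the limit is the tail sum of the increments, estimated by comparing
  \<open>1 / (x + 1)^5\<close> with the increment of \<open>1 / x^4\<close>.\<close>

lemma bigo_telescope_limit:
  fixes box_remainder :: "nat \<Rightarrow> real"
  assumes lim: "box_remainder \<longlonglongrightarrow> L" and inc: "(\<lambda>n. box_remainder (Suc n) - box_remainder n) \<in> O(\<lambda>n. 1 / real (Suc n) ^ 5)"
  shows "(\<lambda>n. box_remainder n - L) \<in> O(\<lambda>n. 1 / real n ^ 4)"
proof -
  obtain C where C: "C > 0" "\<forall>\<^sub>F n in sequentially. norm (box_remainder (Suc n) - box_remainder n) \<le> C * norm (1 / real (Suc n) ^ 5)"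
    using inc by (rule landau_o.bigE)
  then obtain N where N: "\<And>n. n \<ge> N \<Longrightarrow> norm (box_remainder (Suc n) - box_remainder n) \<le> C * norm (1 / real (Suc n) ^ 5)"
    unfolding eventually_sequentially by blast
  have "\<bar>box_remainder n - L\<bar> \<le> C * \<bar>1 / real n ^ 4\<bar>" if n: "n \<ge> Suc N" for n
  proof -
    have bound: "\<bar>box_remainder (n + p) - box_remainder n\<bar> \<le> C * (1 / real n ^ 4 - 1 / real (n + p) ^ 4)" for p
    proof (induction p)
      case (Suc p)
      define x where "x = real (n + p)"
      have x: "x > 0" using n by (simp add: x_def)
      have xs: "real (n + Suc p) = x + 1" by (simp add: x_def)
      have "1 / x ^ 4 - 1 / y ^ 4 - 1 / y ^ 5 = (y ^ 5 - x ^ 4 * y - x ^ 4) / (x ^ 4 * y ^ 5)" if "y > 0" for y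
        using x that by (simp add: field_simps eval_nat_numeral)
      moreover have "(x + 1) ^ 5 - x ^ 4 * (x + 1) - x ^ 4 = 3 * x ^ 4 + 10 * x ^ 3 + 10 * x ^ 2 + 5 * x + 1"
        by algebra
      ultimately have "1 / x ^ 4 - 1 / (x + 1) ^ 4 - 1 / (x + 1) ^ 5
         = (3 * x ^ 4 + 10 * x ^ 3 + 10 * x ^ 2 + 5 * x + 1) / (x ^ 4 * (x + 1) ^ 5)"
        using x by simp
      also have "\<dots> \<ge> 0" using x by simp
      finally have "C * (1 / (x + 1) ^ 5) \<le> C * (1 / x ^ 4 - 1 / (x + 1) ^ 4)"
        using C(1) by (intro mult_left_mono) auto
      moreover have "\<bar>box_remainder (n + Suc p) - box_remainder (n + p)\<bar> \<le> C * (1 / (x + 1) ^ 5)"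
        using N[of "n + p"] n x by (simp add: x_def add_ac)
      moreover have "\<bar>box_remainder (n + Suc p) - box_remainder n\<bar> \<le> \<bar>box_remainder (n + Suc p) - box_remainder (n + p)\<bar> + \<bar>box_remainder (n + p) - box_remainder n\<bar>"
        by linarith
      ultimately show ?case
        using Suc unfolding xs x_def[symmetric] right_diff_distrib by linarith
    qed simp
    have "(\<lambda>p. box_remainder (p + n)) \<longlonglongrightarrow> L" using lim by (rule LIMSEQ_ignore_initial_segment)
    then have "(\<lambda>p. \<bar>box_remainder (n + p) - box_remainder n\<bar>) \<longlonglongrightarrow> \<bar>L - box_remainder n\<bar>"
      by (intro tendsto_intros) (simp add: add.commute)
    then have "\<bar>L - box_remainder n\<bar> \<le> C * (1 / real n ^ 4)"
    proof (rule LIMSEQ_le_const2, intro exI allI impI)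
      fix p
      have "C * (1 / real n ^ 4 - 1 / real (n + p) ^ 4) \<le> C * (1 / real n ^ 4)"
        using C(1) by (intro mult_left_mono) auto
      then show "\<bar>box_remainder (n + p) - box_remainder n\<bar> \<le> C * (1 / real n ^ 4)" using bound[of p] by linarith
    qed
    then show ?thesis by (simp add: abs_minus_commute)
  qed
  then show ?thesis
    by (intro landau_o.bigI[OF C(1)] eventually_sequentiallyI[of "Suc N"]) (simp only: real_norm_def)
qed

lemma bigo_even_odd:
  fixes f g :: "nat \<Rightarrow> real"
  assumes even: "(\<lambda>m. f (2 * Suc m)) \<in> O(\<lambda>m. g (2 * Suc m))"
    and odd: "(\<lambda>m. f (2 * m + 1)) \<in> O(\<lambda>m. g (2 * m + 1))"
  shows "f \<in> O(g)"
proof -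
  obtain C1 N1 where C1: "C1 > 0" "\<And>m. m \<ge> N1 \<Longrightarrow> norm (f (2 * Suc m)) \<le> C1 * norm (g (2 * Suc m))"
    using even by (elim landau_o.bigE) (auto simp: eventually_sequentially)
  obtain C2 N2 where C2: "C2 > 0" "\<And>m. m \<ge> N2 \<Longrightarrow> norm (f (2 * m + 1)) \<le> C2 * norm (g (2 * m + 1))"
    using odd by (elim landau_o.bigE) (auto simp: eventually_sequentially)
  have "norm (f n) \<le> (C1 + C2) * norm (g n)" if n: "n \<ge> 2 * N1 + 2 * N2 + 2" for n
  proof (cases "even n")
    case True
    then obtain k where k: "n = 2 * k" by (elim evenE)
    then obtain m where m: "n = 2 * Suc m" using n by (cases k) auto
    have "m \<ge> N1" using n unfolding m by simp
    then have "norm (f n) \<le> C1 * norm (g n)" unfolding m by (rule C1(2))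
    also have "\<dots> \<le> (C1 + C2) * norm (g n)" using C2(1) by (intro mult_right_mono) auto
    finally show ?thesis .
  next
    case False
    then obtain m where m: "n = 2 * m + 1" by (elim oddE)
    have "m \<ge> N2" using n unfolding m by simp
    then have "norm (f n) \<le> C2 * norm (g n)" unfolding m by (rule C2(2))
    also have "\<dots> \<le> (C1 + C2) * norm (g n)" using C1(1) by (intro mult_right_mono) auto
    finally show ?thesis .
  qed
  then show ?thesis by (intro bigoI[of _ "C1 + C2"] eventually_sequentiallyI)
qed

context pos_form
begin

section \<open>Expansion of the box sums\<close>

definition box_limit :: real where
  "box_limit = 2 / rt * (2 * pi * (euler_mascheroni - ln 2) - 4 * pi * ln (cmod (dedekind_eta mu))
        + (pi / 2 - arctan ((c - a) / rt)) * ln (c / a) - clausen_C a b c)"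

text \<open>With \<open>A\<close> and \<open>B\<close> the coefficients of \<open>1 / m\<close> and
  \<open>1 / m^3\<close> in \<open>ring_expansion\<close>, this is \<open>A / 6 - 2 * B\<close>.
  Since \<open>1 / m - ln ((2 m + 1) / (2 m - 1))\<close> begins with \<open>- 1 / (12 m^3)\<close>
  and \<open>1 / (2 m + 1)^2 - 1 / (2 m - 1)^2\<close> with \<open>- 1 / (2 m^3)\<close>, it is the
  value that removes the cubic term from the increments of \<open>box_remainder\<close>.\<close>

definition second_coeff :: real where
  "second_coeff = 4 * pi / rt / 6 + 2 / 3 * (1 / (a + b + c) + 1 / (a - b + c))"

definition box_remainder :: "nat \<Rightarrow> real" where
  "box_remainder n = box_sum n - 4 * pi / rt * ln (real (2 * n + 1)) - second_coeff / (real (2 * n + 1))\<^sup>2"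

text \<open>Passing from \<open>harm n\<close> to \<open>ln (2 * n + 1)\<close> costs
  \<open>euler_mascheroni - ln 2\<close>.\<close>

lemma V_tendsto: "box_remainder \<longlonglongrightarrow> box_limit"
proof -
  have "(\<lambda>n. harm n - ln (real n)) \<longlonglongrightarrow> (euler_mascheroni :: real)"
    using euler_mascheroni_LIMSEQ by simp
  moreover have "(\<lambda>n. ln (real n) - ln (real (2 * n + 1))) \<longlonglongrightarrow> - ln 2"
    by real_asymp
  moreover have "(\<lambda>n. second_coeff / (real (2 * n + 1))\<^sup>2) \<longlonglongrightarrow> 0" by real_asymp
  ultimately have "(\<lambda>n. (box_sum n - 4 * pi / rt * harm n) + 4 * pi / rt * ((harm n - ln (real n)) + (ln (real n) - ln (real (2 * n + 1))))
      - second_coeff / (real (2 * n + 1))\<^sup>2) \<longlonglongrightarrow>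
      2 / rt * (- 4 * pi * ln (cmod (dedekind_eta mu)) + (pi / 2 - arctan ((c - a) / rt)) * ln (c / a) - clausen_C a b c)
      + 4 * pi / rt * (euler_mascheroni + - ln 2) - 0"
    by (intro tendsto_diff tendsto_add tendsto_mult_left box_harm_limit)
  moreover have "2 / rt * (- 4 * pi * ln (cmod (dedekind_eta mu)) + (pi / 2 - arctan ((c - a) / rt)) * ln (c / a) - clausen_C a b c)
      + 4 * pi / rt * (euler_mascheroni + - ln 2) - 0 = box_limit"
    unfolding box_limit_def by (simp add: algebra_simps add_divide_distrib diff_divide_distrib)
  moreover have "(box_sum n - 4 * pi / rt * harm n) + 4 * pi / rt * ((harm n - ln (real n)) + (ln (real n) - ln (real (2 * n + 1))))
      - second_coeff / (real (2 * n + 1))\<^sup>2 = box_remainder n" for n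
    unfolding box_remainder_def by (simp only: right_diff_distrib distrib_left)
  ultimately show ?thesis by simp
qed

lemma V_rate: "(\<lambda>n. box_remainder n - box_limit) \<in> O(\<lambda>n. 1 / real n ^ 4)"
proof (rule bigo_telescope_limit[OF V_tendsto])
  define A B where "A = 4 * pi / rt" and "B = - (1 / (a + b + c) + 1 / (a - b + c)) / 3"
  have "x / 6 + 2 / 3 * w = x / 6 - 2 * (- w / 3)" for x w :: real by simp
  then have second_coeff: "second_coeff = A / 6 - 2 * B" unfolding second_coeff_def A_def B_def .
  obtain C where C: "\<And>n. \<bar>box_sum (Suc n) - box_sum n - A / real (Suc n) - B / real (Suc n) ^ 3\<bar> \<le> C / real (Suc n) ^ 5"
    using ring_expansion unfolding A_def B_def by blast
  \<comment> \<open>\<open>f\<close> and \<open>g\<close> collect what multiplies \<open>A\<close>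
    and \<open>B\<close> once the exact ring increment is replaced by its expansion; each is of
    fifth order by the choice of \<open>second_coeff\<close>.\<close>
  define f where "f n = 1 / real (Suc n) - ln (2 * real n + 3) + ln (2 * real n + 1)
    - 1 / 6 * (1 / (2 * real n + 3)\<^sup>2 - 1 / (2 * real n + 1)\<^sup>2)" for n
  define g where "g n = 1 / real (Suc n) ^ 3 + 2 * (1 / (2 * real n + 3)\<^sup>2 - 1 / (2 * real n + 1)\<^sup>2)" for n
  have f: "f \<in> O(\<lambda>n. 1 / real (Suc n) ^ 5)" unfolding f_def by real_asymp
  have g: "g \<in> O(\<lambda>n. 1 / real (Suc n) ^ 5)" unfolding g_def by real_asymp
  have e: "(\<lambda>n. box_sum (Suc n) - box_sum n - A / real (Suc n) - B / real (Suc n) ^ 3) \<in> O(\<lambda>n. 1 / real (Suc n) ^ 5)"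
    using C by (intro bigoI[of _ C] always_eventually allI) simp
  have "box_remainder (Suc n) - box_remainder n = (box_sum (Suc n) - box_sum n - A / real (Suc n) - B / real (Suc n) ^ 3) + (A * f n + B * g n)" for n
  proof -
    have r: "real (2 * Suc n + 1) = 2 * real n + 3" "real (2 * n + 1) = 2 * real n + 1" by simp_all
    define x y p q s t where "x = 1 / (2 * real n + 3)\<^sup>2" and "y = 1 / (2 * real n + 1)\<^sup>2"
      and "p = ln (2 * real n + 3)" and "q = ln (2 * real n + 1)"
      and "s = 1 / real (Suc n)" and "t = 1 / real (Suc n) ^ 3"
    have "box_remainder (Suc n) - box_remainder n = box_sum (Suc n) - box_sum n - A * p + A * q - (A / 6 - 2 * B) * x + (A / 6 - 2 * B) * y"
      unfolding box_remainder_def r second_coeff A_def[symmetric] x_def y_def p_def q_def by (simp add: algebra_simps)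
    moreover have "f n = s - p + q - 1 / 6 * (x - y)" "g n = t + 2 * (x - y)"
      unfolding f_def g_def x_def y_def p_def q_def s_def t_def by simp_all
    moreover have "A / real (Suc n) = A * s" "B / real (Suc n) ^ 3 = B * t" by (simp_all add: s_def t_def)
    ultimately show ?thesis
      by (simp only:) (simp add: algebra_simps add_divide_distrib diff_divide_distrib)
  qed
  moreover have "(\<lambda>n. (box_sum (Suc n) - box_sum n - A / real (Suc n) - B / real (Suc n) ^ 3) + (A * f n + B * g n))
      \<in> O(\<lambda>n. 1 / real (Suc n) ^ 5)"
  proof (rule sum_in_bigo(1)[OF e])
    show "(\<lambda>n. A * f n + B * g n) \<in> O(\<lambda>n. 1 / real (Suc n) ^ 5)"
      using f g by (intro sum_in_bigo) simp_all
  qed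
  ultimately show "(\<lambda>n. box_remainder (Suc n) - box_remainder n) \<in> O(\<lambda>n. 1 / real (Suc n) ^ 5)" by simp
qed

section \<open>Half-open squares and the parity of the grid size\<close>

definition half_open_sum :: "nat \<Rightarrow> real" where
  "half_open_sum n = (\<Sum>(j, k)\<in>{j. - int n \<le> 2 * j \<and> 2 * j < int n} \<times> {k. - int n \<le> 2 * k \<and> 2 * k < int n}.
     1 / Q (of_int j) (of_int k))"

lemma box_eq_sum: "box_sum J = (\<Sum>(j, k)\<in>{- int J..int J} \<times> {- int J..int J}. 1 / Q (of_int j) (of_int k))"
  unfolding box_sum_def by (rule sum.cartesian_product)

lemma square_odd: "half_open_sum (2 * M + 1) = box_sum M"
proof -
  have "{j. - int (2 * M + 1) \<le> 2 * j \<and> 2 * j < int (2 * M + 1)} = {- int M..int M}" by auto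
  then show ?thesis unfolding half_open_sum_def box_eq_sum by (simp only:)
qed

text \<open>Inclusion and exclusion for the half-open square \<open>X\<close> and its reflection
  \<open>Y\<close>, which have equal sums. Their intersection is the smaller box; their union is the
  larger box without two opposite corners, and those explain the asymmetric
  \<open>a - b + c\<close>.\<close>

lemma square_even:
  "half_open_sum (2 * Suc m) = (box_sum (Suc m) + box_sum m) / 2 - 1 / ((a - b + c) * (real (Suc m))\<^sup>2)"
proof -
  define M where "M = int (Suc m)"
  define f where "f = (\<lambda>(j, k). 1 / Q (of_int j) (of_int k))"
  define X where "X = {- M..M - 1} \<times> {- M..M - 1}"
  define Y where "Y = {- (M - 1)..M} \<times> {- (M - 1)..M}"
  define Z where "Z = {- M..M} \<times> {- M..M}"
  define E where "E = {(- M, M), (M, - M)}"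
  have Mp: "M > 0" by (simp add: M_def)
  have "{j. - int (2 * Suc m) \<le> 2 * j \<and> 2 * j < int (2 * Suc m)} = {- M..M - 1}" by (auto simp: M_def)
  then have sX: "half_open_sum (2 * Suc m) = sum f X" unfolding half_open_sum_def X_def f_def by (simp only:)
  have sY: "sum f Y = sum f X"
  proof (rule sum.reindex_bij_witness[where i = "\<lambda>(j, k). (- j, - k)" and j = "\<lambda>(j, k). (- j, - k)"])
    show "f (case p of (j, k) \<Rightarrow> (- j, - k)) = f p" for p
      by (cases p) (simp add: f_def Q_uminus)
  qed (auto simp: X_def Y_def)
  \<comment> \<open>A point of the larger box outside both squares must have one coordinate
    \<open>M\<close> and the other \<open>- M\<close>.\<close>
  have "X \<union> Y = Z - E" using Mp by (auto simp: X_def Y_def Z_def E_def)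
  then have sU: "sum f (X \<union> Y) = sum f Z - sum f E"
    using Mp by (simp only:) (intro sum_diff, auto simp: Z_def E_def)
  have "X \<inter> Y = {- int m..int m} \<times> {- int m..int m}" by (auto simp: X_def Y_def M_def)
  then have sI: "sum f (X \<inter> Y) = box_sum m" unfolding box_eq_sum f_def by (simp only:)
  have sZ: "sum f Z = box_sum (Suc m)" unfolding box_eq_sum f_def Z_def M_def ..
  have "f (- M, M) = 1 / ((a - b + c) * (real (Suc m))\<^sup>2)" "f (M, - M) = 1 / ((a - b + c) * (real (Suc m))\<^sup>2)"
    unfolding f_def M_def Q_def by (simp_all add: algebra_simps power2_eq_square)
  then have sE: "sum f E = 2 * (1 / ((a - b + c) * (real (Suc m))\<^sup>2))"
    unfolding E_def using Mp by (subst sum.insert) auto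
  have "sum f (X \<union> Y) + sum f (X \<inter> Y) = sum f X + sum f Y"
    by (rule sum.union_inter) (simp_all add: X_def Y_def)
  moreover have "x = (z + i) / 2 - e" if "z - 2 * e + i = x + x" for x z i e :: real
    using that by (simp add: field_simps)
  ultimately show ?thesis unfolding sU sI sY sZ sE sX by blast
qed

text \<open>For odd \<open>n\<close> the difference is exactly
  \<open>box_remainder m - box_limit\<close>. For even \<open>n\<close> the two boxes belong to the
  odd sizes \<open>n - 1\<close> and \<open>n + 1\<close>. Averaging their logarithms gives
  \<open>ln n - 1 / (2 n^2)\<close> up to \<open>O(n^-4)\<close>, which is the origin of
  \<open>2 * pi / rt\<close>; the missing corners give \<open>4 / (a - b + c)\<close>.\<close>

lemma square_expansion:
  "(\<lambda>n. half_open_sum n - (4 * pi / rt * ln (real n) + box_limit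
      + (second_coeff - (1 + (-1) ^ n) / 2 * (2 * pi / rt + 4 / (a - b + c))) / (real n)\<^sup>2)) \<in> O(\<lambda>n. 1 / real n ^ 4)"
proof -
  define A where "A = 4 * pi / rt"
  define R where "R n = half_open_sum n - (A * ln (real n) + box_limit
      + (second_coeff - (1 + (-1) ^ n) / 2 * (A / 2 + 4 / (a - b + c))) / (real n)\<^sup>2)" for n
  have "R \<in> O(\<lambda>n. 1 / real n ^ 4)"
  proof (rule bigo_even_odd)
    \<comment> \<open>These are the errors in replacing the averages over \<open>n - 1\<close> and
      \<open>n + 1\<close> by values at \<open>n\<close>, with the quadratic term of the logarithm
      put back; both are of order \<open>n^-4\<close>.\<close>
    define f where "f m = 1 / 2 * ln (2 * real m + 3) + 1 / 2 * ln (2 * real m + 1) - ln (2 * real m + 2)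
      + 1 / 2 / (2 * real m + 2)\<^sup>2" for m
    define g where "g m = 1 / 2 / (2 * real m + 3)\<^sup>2 + 1 / 2 / (2 * real m + 1)\<^sup>2 - 1 / (2 * real m + 2)\<^sup>2" for m
    have V1: "(\<lambda>m. box_remainder m - box_limit) \<in> O(\<lambda>m. 1 / real (2 * Suc m) ^ 4)"
      by (rule landau_o.big_trans[OF V_rate]) real_asymp
    have V2: "(\<lambda>m. box_remainder (Suc m) - box_limit) \<in> O(\<lambda>m. 1 / real (2 * Suc m) ^ 4)"
    proof -
      have "(\<lambda>m. box_remainder (Suc m) - box_limit) \<in> O(\<lambda>m. 1 / real (Suc m) ^ 4)"
        by (rule landau_o.big.compose[OF V_rate filterlim_Suc])
      also have "(\<lambda>m. 1 / real (Suc m) ^ 4) \<in> O(\<lambda>m. 1 / real (2 * Suc m) ^ 4)" by real_asymp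
      finally show ?thesis .
    qed
    have f: "f \<in> O(\<lambda>m. 1 / real (2 * Suc m) ^ 4)" unfolding f_def by real_asymp
    have g: "g \<in> O(\<lambda>m. 1 / real (2 * Suc m) ^ 4)" unfolding g_def by real_asymp
    have "R (2 * Suc m) = 1 / 2 * (box_remainder m - box_limit) + 1 / 2 * (box_remainder (Suc m) - box_limit) + (A * f m + second_coeff * g m)" for m
    proof -
      define x where "x = real m + 1"
      have x: "x > 0" by (simp add: x_def)
      have r: "real (2 * Suc m) = 2 * x" "real (2 * Suc m + 1) = 2 * real m + 3"
        "real (2 * m + 1) = 2 * real m + 1" "real (Suc m) = x" "2 * real m + 2 = 2 * x" by (simp_all add: x_def)
      have one: "(1 + (- 1) ^ (2 * Suc m)) / 2 = (1 :: real)" by simp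
      define p q s u v w e where "p = ln (2 * real m + 3)" and "q = ln (2 * real m + 1)" and "s = ln (2 * x)"
        and "u = 1 / (2 * real m + 3)\<^sup>2" and "v = 1 / (2 * real m + 1)\<^sup>2" and "w = 1 / (2 * x)\<^sup>2"
        and "e = 1 / (a - b + c)"
      have e1: "1 / ((a - b + c) * x\<^sup>2) = 4 * e * w" using x by (simp add: e_def w_def power_mult_distrib)
      have "R (2 * Suc m) = (box_sum (Suc m) + box_sum m) / 2 - 4 * e * w - (A * s + box_limit + (second_coeff - (A / 2 + 4 * e)) * w)"
        unfolding R_def square_even one r(1) r(4) e1 mult_1 by (simp add: s_def w_def e_def)
      moreover have "box_remainder (Suc m) = box_sum (Suc m) - A * p - second_coeff * u" "box_remainder m = box_sum m - A * q - second_coeff * v"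
        unfolding box_remainder_def r A_def p_def q_def u_def v_def by simp_all
      moreover have "f m = 1 / 2 * p + 1 / 2 * q - s + 1 / 2 * w" "g m = 1 / 2 * u + 1 / 2 * v - w"
        unfolding f_def g_def r(5) p_def q_def s_def u_def v_def w_def by simp_all
      ultimately show ?thesis by (simp only:) (simp add: field_simps)
    qed
    moreover have "(\<lambda>m. 1 / 2 * (box_remainder m - box_limit) + 1 / 2 * (box_remainder (Suc m) - box_limit) + (A * f m + second_coeff * g m)) \<in> O(\<lambda>m. 1 / real (2 * Suc m) ^ 4)"
      using V1 V2 f g by (intro sum_in_bigo) simp_all
    ultimately show "(\<lambda>m. R (2 * Suc m)) \<in> O(\<lambda>m. 1 / real (2 * Suc m) ^ 4)" by simp
    have "R (2 * m + 1) = box_remainder m - box_limit" for m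
    proof -
      have "(1 + (- 1) ^ (2 * m + 1)) / 2 = (0 :: real)" by simp
      then show ?thesis unfolding R_def square_odd box_remainder_def A_def by (simp only: mult_zero_left) simp
    qed
    moreover have "(\<lambda>m. box_remainder m - box_limit) \<in> O(\<lambda>m. 1 / real (2 * m + 1) ^ 4)"
      by (rule landau_o.big_trans[OF V_rate]) real_asymp
    ultimately show "(\<lambda>m. R (2 * m + 1)) \<in> O(\<lambda>m. 1 / real (2 * m + 1) ^ 4)" by simp
  qed
  then show ?thesis unfolding R_def[abs_def] A_def by simp
qed

lemma grid_sum_eq_square:
  assumes f: "\<And>x y. f (x, y) = D / Q x y" and n: "n > 0"
  shows "grid_sum n f = D * (real n)\<^sup>2 / (4 * pi\<^sup>2) * half_open_sum n"
proof -
  define I where "I = {j. - int n \<le> 2 * j \<and> 2 * j < int n}"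
  have fin: "finite I" by (rule finite_subset[of _ "{- int n..int n}"]) (auto simp: I_def)
  have g: "grid n j \<in> {-pi..<pi} \<longleftrightarrow> j \<in> I" for j
  proof -
    have "grid n j = pi * (2 * of_int j / real n)" by (simp add: grid_def)
    moreover have "- pi = pi * (- 1)" "pi = pi * 1" by simp_all
    ultimately have "grid n j \<in> {-pi..<pi} \<longleftrightarrow> - 1 \<le> 2 * of_int j / real n \<and> 2 * of_int j / real n < 1"
      using mult_le_cancel_left_pos[OF pi_gt_zero, of "-1" "2 * of_int j / real n"]
        mult_less_cancel_left_pos[OF pi_gt_zero, of "2 * of_int j / real n" 1] by simp
    also have "\<dots> \<longleftrightarrow> - real n \<le> 2 * of_int j \<and> 2 * of_int j < real n"
      using n by (simp add: field_simps)
    also have "\<dots> \<longleftrightarrow> j \<in> I" unfolding I_def mem_Collect_eq by linarith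
    finally show ?thesis .
  qed
  have g0: "grid n j = 0 \<longleftrightarrow> j = 0" for j using n by (simp add: grid_def)
  have set: "{(j, k). grid_pt n j k \<in> grid_region n} = I \<times> I - {(0, 0)}"
    unfolding grid_pt_in_region_iff[OF n]
    by (auto simp: punctured_square_def grid_pt_def g[symmetric] g0)
  have val: "f (grid_pt n j k) = D * (real n)\<^sup>2 / (4 * pi\<^sup>2) * (1 / Q (of_int j) (of_int k))" for j k
  proof -
    have "Q (grid n j) (grid n k) = (2 * pi / real n)\<^sup>2 * Q (of_int j) (of_int k)"
      unfolding Q_scale[symmetric] by (simp add: grid_def)
    then show ?thesis unfolding grid_pt_def f by (simp add: power_divide power_mult_distrib)
  qed
  have "grid_sum n f = (\<Sum>(j, k)\<in>I \<times> I - {(0, 0)}. f (grid_pt n j k))"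
    unfolding grid_sum_def set ..
  also have "\<dots> = (\<Sum>(j, k)\<in>I \<times> I - {(0, 0)}. D * (real n)\<^sup>2 / (4 * pi\<^sup>2) * (1 / Q (of_int j) (of_int k)))"
    unfolding val ..
  also have "\<dots> = (\<Sum>(j, k)\<in>I \<times> I. D * (real n)\<^sup>2 / (4 * pi\<^sup>2) * (1 / Q (of_int j) (of_int k)))"
    \<comment> \<open>The origin may be restored, as its term is a multiple of
      \<open>1 / 0 = 0\<close>.\<close>
    by (rule sum.mono_neutral_left) (use fin in \<open>auto simp: Q_def\<close>)
  also have "\<dots> = D * (real n)\<^sup>2 / (4 * pi\<^sup>2) * half_open_sum n"
    unfolding half_open_sum_def I_def sum_distrib_left by (intro sum.cong refl) (simp add: case_prod_beta)
  finally show ?thesis .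
qed

end

section \<open>From the lattice vectors to the quadratic form\<close>

lemma independent_pair_zero:
  fixes x y :: "'v::real_vector"
  assumes "independent {x, y}" "x \<noteq> y" "\<alpha> *\<^sub>R x + \<beta> *\<^sub>R y = 0"
  shows "\<alpha> = 0" "\<beta> = 0"
proof -
  have "\<not> (\<exists>u. (\<exists>v\<in>{x, y}. u v \<noteq> 0) \<and> (\<Sum>v\<in>{x, y}. u v *\<^sub>R v) = 0)"
    using assms(1) dependent_finite[of "{x, y}"] by simp
  note this[unfolded not_ex, THEN spec, of "\<lambda>v. if v = x then \<alpha> else \<beta>"]
  moreover have "(\<Sum>v\<in>{x, y}. (if v = x then \<alpha> else \<beta>) *\<^sub>R v) = 0" using assms(2,3) by simp
  ultimately show "\<alpha> = 0" "\<beta> = 0" using assms(2) by (auto split: if_splits)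
qed

theorem theorem4:
  fixes N :: nat
    and bv :: "nat \<Rightarrow> 'v::real_vector"
    and s1 s2 :: "nat \<Rightarrow> int"
    and a b c d :: real
    and \<mu> :: complex
  assumes dim2: "dim (UNIV :: 'v set) = 2"
    and size: "N \<ge> 2"
    and nonzero: "\<And>l. l \<in> {1..N} \<Longrightarrow> bv l \<noteq> 0"
    and full_rank: "span (int_span (bv ` {1..N})) = (UNIV :: 'v set)"
    and basis: "bv 1 \<noteq> bv 2" "is_lattice_basis {bv 1, bv 2} (int_span (bv ` {1..N}))"
    and coords: "\<And>l. l \<in> {1..N} \<Longrightarrow>
      bv l = real_of_int (s1 l) *\<^sub>R bv 1 + real_of_int (s2 l) *\<^sub>R bv 2"
    and a_eq: "a = (\<Sum>l = 1..N. (real_of_int (s1 l))\<^sup>2)"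
    and b_eq: "b = 2 * (\<Sum>l = 1..N. real_of_int (s1 l) * real_of_int (s2 l))"
    and c_eq: "c = (\<Sum>l = 1..N. (real_of_int (s2 l))\<^sup>2)"
    and d_eq: "d = b\<^sup>2 - 4 * a * c"
    and \<mu>_eq: "\<mu> = (- of_real b + of_real (sqrt \<bar>d\<bar>) * \<i>) / (2 * of_real c)"
  shows "(\<lambda>n::nat. grid_sum n (f1 N s1 s2) -
      (2 * real N / (pi * sqrt \<bar>d\<bar>) * (real n)\<^sup>2 * ln (real n)
       + real N / (pi\<^sup>2 * sqrt \<bar>d\<bar>) *
           (2 * pi * (euler_mascheroni - ln 2)
            - 4 * pi * ln (cmod (dedekind_eta \<mu>))
            + (pi / 2 - arctan ((c - a) / sqrt \<bar>d\<bar>)) * ln (c / a)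
            - clausen_C a b c) * (real n)\<^sup>2
       + real N / pi\<^sup>2 *
           (1 / 3 * (1 / (a - b + c) + 1 / (a + b + c) + pi / sqrt \<bar>d\<bar>)
            - (1 + (-1) ^ n) / 2 * (pi / sqrt \<bar>d\<bar> + 2 / (a - b + c)))))
    \<in> O(\<lambda>n. ln (real n) / (real n)\<^sup>2)"
proof -
  have ind: "independent {bv 1, bv 2}" using basis(2) by (simp add: is_lattice_basis_def)
  \<comment> \<open>Independence of the basis makes coordinates unique, so the first two coordinate
    vectors are the unit vectors.\<close>
  have "(real_of_int (s1 1) - 1) *\<^sub>R bv 1 + real_of_int (s2 1) *\<^sub>R bv 2 = 0"
    using coords[of 1] size by (simp add: algebra_simps)
  note s1 = independent_pair_zero[OF ind basis(1) this]
  have "real_of_int (s1 2) *\<^sub>R bv 1 + (real_of_int (s2 2) - 1) *\<^sub>R bv 2 = 0"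
    using coords[of 2] size by (simp add: algebra_simps)
  note s2 = independent_pair_zero[OF ind basis(1) this]
  have form: "(\<Sum>l = 1..N. (real_of_int (s1 l) * x + real_of_int (s2 l) * y)\<^sup>2) = a * x\<^sup>2 + b * x * y + c * y\<^sup>2" for x y
  proof -
    have "(\<Sum>l = 1..N. (real_of_int (s1 l) * x + real_of_int (s2 l) * y)\<^sup>2)
      = (\<Sum>l = 1..N. (real_of_int (s1 l))\<^sup>2 * x\<^sup>2 + real_of_int (s1 l) * real_of_int (s2 l) * (2 * x * y) + (real_of_int (s2 l))\<^sup>2 * y\<^sup>2)"
      by (intro sum.cong refl) (simp add: power2_eq_square algebra_simps)
    also have "\<dots> = a * x\<^sup>2 + (\<Sum>l = 1..N. real_of_int (s1 l) * real_of_int (s2 l)) * (2 * x * y) + c * y\<^sup>2"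
      unfolding a_eq c_eq sum.distrib sum_distrib_right[symmetric] ..
    finally show ?thesis by (simp add: b_eq)
  qed
  \<comment> \<open>The first two vectors alone contribute \<open>x^2 + y^2\<close>, and all other
    summands are squares.\<close>
  have lower: "x\<^sup>2 + y\<^sup>2 \<le> a * x\<^sup>2 + b * x * y + c * y\<^sup>2" for x y
  proof -
    have "x\<^sup>2 + y\<^sup>2 = (\<Sum>l \<in> {1, 2}. (real_of_int (s1 l) * x + real_of_int (s2 l) * y)\<^sup>2)"
      using s1 s2 by simp
    also have "\<dots> \<le> (\<Sum>l = 1..N. (real_of_int (s1 l) * x + real_of_int (s2 l) * y)\<^sup>2)"
      using size by (intro sum_mono2) auto
    finally show ?thesis unfolding form .
  qed
  have ac: "a \<ge> 1" "c \<ge> 1" using lower[of 1 0] lower[of 0 1] by simp_all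
  \<comment> \<open>At the point \<open>(- b, 2 * a)\<close> the form equals \<open>a\<close> times
    minus the discriminant, so the lower bound gives definiteness.\<close>
  have "a * (4 * a * c - b\<^sup>2) = a * (- b)\<^sup>2 + b * (- b) * (2 * a) + c * (2 * a)\<^sup>2"
    by (simp add: power2_eq_square algebra_simps)
  also have "\<dots> \<ge> (- b)\<^sup>2 + (2 * a)\<^sup>2" by (rule lower)
  finally have "a * (4 * a * c - b\<^sup>2) > 0"
    using ac by (smt (verit) zero_less_power zero_le_power2)
  then have disc: "b\<^sup>2 < 4 * a * c" using ac by (simp add: zero_less_mult_iff)
  interpret pos_form a b c using ac disc by unfold_locales auto
  have rt: "sqrt \<bar>d\<bar> = rt" using disc by (simp add: rt_def d_eq)
  have mu: "\<mu> = mu" unfolding \<mu>_eq rt mu_def using c_pos by (simp add: complex_eq_iff Re_divide Im_divide power2_eq_square)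
  have f1: "f1 N s1 s2 (x, y) = 2 * real N / Q x y" for x y
    unfolding f1_def p1_def Q_def form[symmetric] by simp
  define T where "T n = half_open_sum n - (4 * pi / rt * ln (real n) + box_limit
      + (second_coeff - (1 + (-1) ^ n) / 2 * (2 * pi / rt + 4 / (a - b + c))) / (real n)\<^sup>2)" for n
  have T: "T \<in> O(\<lambda>n. 1 / real n ^ 4)" unfolding T_def by (rule square_expansion)
  have eq: "grid_sum n (f1 N s1 s2) -
      (2 * real N / (pi * rt) * (real n)\<^sup>2 * ln (real n)
       + real N / (pi\<^sup>2 * rt) *
           (2 * pi * (euler_mascheroni - ln 2)
            - 4 * pi * ln (cmod (dedekind_eta mu))
            + (pi / 2 - arctan ((c - a) / rt)) * ln (c / a)
            - clausen_C a b c) * (real n)\<^sup>2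
       + real N / pi\<^sup>2 *
           (1 / 3 * (1 / (a - b + c) + 1 / (a + b + c) + pi / rt)
            - (1 + (-1) ^ n) / 2 * (pi / rt + 2 / (a - b + c)))) = real N / (2 * pi\<^sup>2) * ((real n)\<^sup>2 * T n)"
    if n: "n > 0" for n
  proof -
    define H where "H = 2 * pi * (euler_mascheroni - ln 2)
            - 4 * pi * ln (cmod (dedekind_eta mu))
            + (pi / 2 - arctan ((c - a) / rt)) * ln (c / a)
            - clausen_C a b c"
    define l x y p where "l = ln (real n)" and "x = 1 / (a - b + c)" and "y = 1 / (a + b + c)"
      and "p = (1 + (-1) ^ n) / (2 :: real)"
    define r where "r = 1 / rt"
    have K: "box_limit = 2 * r * H" unfolding box_limit_def H_def r_def by simp
    have second_coeff: "second_coeff = 2 / 3 * (pi * r + x + y)" unfolding second_coeff_def r_def x_def y_def by simp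
    have G: "grid_sum n (f1 N s1 s2) = real N * (real n)\<^sup>2 / (2 * pi\<^sup>2) * half_open_sum n"
      using grid_sum_eq_square[OF f1 n] by simp
    have T': "(real n)\<^sup>2 * T n = (real n)\<^sup>2 * half_open_sum n - (real n)\<^sup>2 * (4 * pi * r * l + 2 * r * H)
       - (2 / 3 * (pi * r + x + y) - p * (2 * pi * r + 4 * x))"
      unfolding T_def K second_coeff using n by (simp add: r_def l_def x_def p_def field_simps)
    have "grid_sum n (f1 N s1 s2) - (2 * real N * r / pi * (real n)\<^sup>2 * l + real N * r / pi\<^sup>2 * H * (real n)\<^sup>2
       + real N / pi\<^sup>2 * (1 / 3 * (x + y + pi * r) - p * (pi * r + 2 * x))) = real N / (2 * pi\<^sup>2) * ((real n)\<^sup>2 * T n)"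
      unfolding G T' by (simp add: field_simps power2_eq_square)
    moreover have "2 * real N / (pi * rt) = 2 * real N * r / pi" "real N / (pi\<^sup>2 * rt) = real N * r / pi\<^sup>2"
      "pi / rt = pi * r" "2 / (a - b + c) = 2 * x" by (simp_all add: r_def x_def)
    ultimately show ?thesis
      unfolding H_def[symmetric] l_def[symmetric] p_def[symmetric] x_def[symmetric] y_def[symmetric]
      by (simp only:)
  qed
  have "(\<lambda>n. real N / (2 * pi\<^sup>2) * ((real n)\<^sup>2 * T n)) \<in> O(\<lambda>n. (real n)\<^sup>2 * (1 / real n ^ 4))"
    using landau_o.big.mult[OF landau_o.big_refl T] by simp
  \<comment> \<open>What has been proved is the sharper order \<open>1 / n^2\<close>; it is weakened
    here to the stated bound.\<close>
  also have "(\<lambda>n. (real n)\<^sup>2 * (1 / real n ^ 4)) \<in> O(\<lambda>n. ln (real n) / (real n)\<^sup>2)"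
    by real_asymp
  finally have "(\<lambda>n. real N / (2 * pi\<^sup>2) * ((real n)\<^sup>2 * T n)) \<in> O(\<lambda>n. ln (real n) / (real n)\<^sup>2)" .
  then show ?thesis
    unfolding rt mu
    by (rule landau_o.big.in_cong[THEN iffD2, rotated])
      (rule eventually_mono[OF eventually_gt_at_top[of 0]], rule eq)
qed

end
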